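(* Let $p\ge1$ and consider the model $\mathbf Y=\mathbf X+\mathbf Z_1$, $\mathbf X=\mathbf 1\Theta+\Sigma^{1/2}\mathbf Z_2$, where $\mathbf Z_1=(Z_{11},\dots,Z_{1p})$ has i.i.d. standard Cauchy entries, $\mathbf Z_2=(Z_{21},\dots,Z_{2p})$ has i.i.d. standard Gaussian entries independent of $\mathbf Z_1$, $\mathbf 1\in\mathbb R^p$ is the vector of ones, $\Sigma$ is a known $p\times p$ positive definite covariance matrix, and $\Theta\in\mathbb R$ has the improper flat prior. Fix observed data $\mathbf y$. Then (1) the Gibbs sampler under the centred parametrisation $\mathcal P_0=(\mathbf X,\Theta)$ fails to be geometrically ergodic; (2) the Gibbs sampler under the non-centred parametrisation $\mathcal P_1=(\tilde{\mathbf X},\Theta)$, $\tilde{\mathbf X}=\mathbf X-\mathbf 1\Theta$, is uniformly ergodic.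
   Context: For a parametrisation $(\mathbf U,\Theta)$ with $\mathbf U\in\{\mathbf X,\tilde{\mathbf X}\}$, the Gibbs sampler started at $\Theta_0$ iterates, for $n\ge1$: draw $\mathbf U_n\sim\mathcal L(\mathbf U\mid\mathbf Y=\mathbf y,\Theta=\Theta_{n-1})$, then $\Theta_n\sim\mathcal L(\Theta\mid\mathbf Y=\mathbf y,\mathbf U=\mathbf U_n)$. It is called geometrically ergodic if the marginal chain $\{\Theta_n\}$ satisfies $\|\mathcal L(\Theta_n\mid\mathbf Y=\mathbf y,\Theta_0)-\mathcal L(\Theta\mid\mathbf Y=\mathbf y)\|_{TV}\le M(\Theta_0)r^n$ for all $n$, for some $r<1$ and some function $M$, and uniformly ergodic if in addition $M$ can be taken bounded. *)

theory Defs
  imports "HOL-Probability.Probability"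
begin

definition cauchy_dens :: "real \<Rightarrow> real" where
  "cauchy_dens t = 1 / (pi * (1 + t\<^sup>2))"

definition gauss_dens :: "real^'p^'p \<Rightarrow> real^'p \<Rightarrow> real" where
  "gauss_dens S v = exp (- (v \<bullet> (matrix_inv S *v v)) / 2) / sqrt ((2 * pi) ^ CARD('p) * det S)"

definition ones :: "real^'p" where
  "ones = (\<chi> i. 1)"

definition normalise :: "'a measure \<Rightarrow> ('a \<Rightarrow> ennreal) \<Rightarrow> 'a measure" where
  "normalise M f = density M (\<lambda>x. f x / (\<integral>\<^sup>+ z. f z \<partial>M))"

text \<open>Joint density of (Y, X, Theta) at Y = y (flat prior on Theta), as a function of
  (X, Theta) = (x, theta): centred parametrisation P0.\<close>
definition centred_dens :: "real^'p^'p \<Rightarrow> real^'p \<Rightarrow> real^'p \<Rightarrow> real \<Rightarrow> real" where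
  "centred_dens S y x \<theta> = gauss_dens S (x - \<theta> *\<^sub>R ones) * (\<Prod>i\<in>UNIV. cauchy_dens (y $ i - x $ i))"

text \<open>Joint density of (Y, Xtilde, Theta) at Y = y, Xtilde = X - 1 Theta: non-centred P1.\<close>
definition noncentred_dens :: "real^'p^'p \<Rightarrow> real^'p \<Rightarrow> real^'p \<Rightarrow> real \<Rightarrow> real" where
  "noncentred_dens S y xt \<theta> = gauss_dens S xt * (\<Prod>i\<in>UNIV. cauchy_dens (y $ i - xt $ i - \<theta>))"

definition theta_posterior :: "real^'p^'p \<Rightarrow> real^'p \<Rightarrow> real measure" where
  "theta_posterior S y = normalise lborel (\<lambda>\<theta>. \<integral>\<^sup>+ x. ennreal (centred_dens S y x \<theta>) \<partial>lborel)"

text \<open>One Gibbs sweep for the marginal Theta-chain, given the joint density pi of (U, Theta)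
  conditional on Y = y: U ~ L(U | y, Theta), then Theta ~ L(Theta | y, U).\<close>
definition gibbs_kernel :: "(real^'p \<Rightarrow> real \<Rightarrow> real) \<Rightarrow> real \<Rightarrow> real measure" where
  "gibbs_kernel \<pi> \<theta> =
     normalise lborel (\<lambda>u. ennreal (\<pi> u \<theta>)) \<bind> (\<lambda>u. normalise lborel (\<lambda>t. ennreal (\<pi> u t)))"

primrec gibbs_chain :: "(real^'p \<Rightarrow> real \<Rightarrow> real) \<Rightarrow> real \<Rightarrow> nat \<Rightarrow> real measure" where
  "gibbs_chain \<pi> \<theta>0 0 = return lborel \<theta>0"
| "gibbs_chain \<pi> \<theta>0 (Suc n) = gibbs_chain \<pi> \<theta>0 n \<bind> gibbs_kernel \<pi>"

definition tv_dist :: "real measure \<Rightarrow> real measure \<Rightarrow> real" where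
  "tv_dist M N = (SUP A \<in> sets borel. \<bar>measure M A - measure N A\<bar>)"

definition geometrically_ergodic :: "(real^'p \<Rightarrow> real \<Rightarrow> real) \<Rightarrow> real measure \<Rightarrow> bool" where
  "geometrically_ergodic \<pi> target \<longleftrightarrow>
     (\<exists>r::real. \<exists>M::real \<Rightarrow> real. 0 \<le> r \<and> r < 1 \<and>
        (\<forall>\<theta>0 n. tv_dist (gibbs_chain \<pi> \<theta>0 n) target \<le> M \<theta>0 * r ^ n))"

definition uniformly_ergodic :: "(real^'p \<Rightarrow> real \<Rightarrow> real) \<Rightarrow> real measure \<Rightarrow> bool" where
  "uniformly_ergodic \<pi> target \<longleftrightarrow>
     (\<exists>r::real. \<exists>M::real \<Rightarrow> real. 0 \<le> r \<and> r < 1 \<and> bdd_above (range M) \<and>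
        (\<forall>\<theta>0 n. tv_dist (gibbs_chain \<pi> \<theta>0 n) target \<le> M \<theta>0 * r ^ n))"

end

(*
  Shifting a Cauchy density by a changes it by a factor at most 2 (1 + a^2), uniformly in its
  argument, and Gaussian laws integrate products of such factors. Hence, up to constants, the
  marginal density of (y, theta) is kappa(theta) = cauchy(theta)^p, and the density of Xtilde
  given theta lies between gauss / rho and gauss * rho for a polynomial rho independent of theta.

  The lower bound minorises the non-centred kernel uniformly in theta (Doeblin), so every sweep
  contracts the oscillation of a bounded function by a fixed factor.

  The upper bound shows that one sweep of the centred sampler multiplies the mean of exp |theta|
  by at most a constant B. By Markov's inequality the chain started at 0 exceeds L n after n steps
  with probability at most 2^-n once L >= ln (2 B), whereas the posterior gives this event at least
  the order of n^(-2p).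
*)
theory Submission
  imports Defs
begin

section \<open>Normalised densities\<close>

text \<open>The samplers differ in how far one sweep can carry theta. For large |theta| the heavy
  Cauchy tails let Y - X absorb the discrepancy, so X given theta stays at bounded scale around
  theta times the vector of ones. The centred scheme then redraws Theta from a Gaussian of fixed
  variance, whose mean is a linear functional of X equal to 1 at the vector of ones: the chain moves
  like a random walk. Since the posterior tail is only polynomial, geometric convergence would
  require distances exponential in n, while such steps reach distances linear in n. In the
  non-centred scheme Xtilde hardly feels theta, and Theta is redrawn from a product of Cauchy
  factors that does not remember the old value.

  What makes both halves short is the separated form of the bounds, kappa(theta) times a function of
  Xtilde: kappa cancels as soon as the law of Xtilde given theta is normalised, so no asymptotics in
  theta are needed. The flat prior has infinite mass, so properness of the posterior must be proved;
  it comes from integrability of kappa, where p \<ge> 1 enters. For fixed theta the two joint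
  densities differ by a translation, hence share one target.\<close>

lemma sets_normalise [simp, measurable_cong]: "sets (normalise M f) = sets M"
  by (simp add: normalise_def)

lemma space_normalise [simp]: "space (normalise M f) = space M"
  by (simp add: normalise_def)

lemma nn_integral_normalise:
  assumes [measurable]: "f \<in> borel_measurable M" "g \<in> borel_measurable M"
  shows "(\<integral>\<^sup>+ x. g x \<partial>normalise M f) = (\<integral>\<^sup>+ x. f x * g x \<partial>M) / (\<integral>\<^sup>+ x. f x \<partial>M)"
proof -
  have "(\<integral>\<^sup>+ x. g x \<partial>normalise M f) = (\<integral>\<^sup>+ x. f x / (\<integral>\<^sup>+ z. f z \<partial>M) * g x \<partial>M)"
    unfolding normalise_def by (rule nn_integral_density) measurable
  also have "\<dots> = (\<integral>\<^sup>+ x. (f x * g x) / (\<integral>\<^sup>+ z. f z \<partial>M) \<partial>M)"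
    by (simp add: ennreal_times_divide mult.commute)
  finally show ?thesis
    by (simp add: nn_integral_divide)
qed

lemma prob_space_normalise:
  assumes [measurable]: "f \<in> borel_measurable M"
    and "0 < (\<integral>\<^sup>+ x. f x \<partial>M)" "(\<integral>\<^sup>+ x. f x \<partial>M) < \<infinity>"
  shows "prob_space (normalise M f)"
proof
  have "emeasure (normalise M f) (space (normalise M f)) = (\<integral>\<^sup>+ x. 1 \<partial>normalise M f)"
    by (simp add: nn_integral_const)
  also have "\<dots> = 1"
    using assms(2,3) by (subst nn_integral_normalise) (auto intro!: ennreal_divide_self simp: top_unique)
  finally show "emeasure (normalise M f) (space (normalise M f)) = 1" .
qed

text \<open>A vanishing integral would force f = 0 almost everywhere, that is nowhere, although the
  whole space is not null. This supplies the positivity of every normalising constant below.\<close>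

lemma nn_integral_lborel_pos:
  fixes f :: "'a::euclidean_space \<Rightarrow> ennreal"
  assumes [measurable]: "f \<in> borel_measurable borel" and "\<And>x. 0 < f x"
  shows "0 < (\<integral>\<^sup>+ x. f x \<partial>lborel)"
proof (rule ccontr)
  assume "\<not> ?thesis"
  then have "(\<integral>\<^sup>+ x. f x \<partial>lborel) = 0"
    by (simp add: zero_less_iff_neq_zero)
  then have "AE x in (lborel :: 'a measure). False"
    using assms(2) by (subst (asm) nn_integral_0_iff_AE) (auto simp: zero_less_iff_neq_zero)
  then show False
    by (auto dest!: AE_E3 simp: AE_iff_null)
qed

lemma nn_integral_lborel_translate:
  fixes f :: "'a::euclidean_space \<Rightarrow> ennreal"
  assumes [measurable]: "f \<in> borel_measurable borel"
  shows "(\<integral>\<^sup>+ x. f x \<partial>lborel) = (\<integral>\<^sup>+ x. f (c + x) \<partial>lborel)"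
  by (subst lborel_distr_plus[of c, symmetric]) (simp add: nn_integral_distr)

text \<open>The bind is the join of the image of M under K, so the integral of a signed bounded f
  can be taken in two stages. The Doeblin argument uses this to peel off one transition.\<close>

lemma integral_bind_bounded:
  fixes f :: "'b \<Rightarrow> real"
  assumes K [measurable]: "K \<in> M \<rightarrow>\<^sub>M prob_algebra N" and "prob_space M"
    and f [measurable]: "f \<in> borel_measurable N" and bdd: "\<And>x. \<bar>f x\<bar> \<le> B"
  shows "(\<integral>x. f x \<partial>(M \<bind> K)) = (\<integral>x. (\<integral>t. f t \<partial>K x) \<partial>M)"
proof -
  interpret M: prob_space M by fact
  have K' [measurable]: "K \<in> M \<rightarrow>\<^sub>M subprob_algebra N"
    using K by (rule measurable_prob_algebraD)
  have fin: "finite_measure (distr M (subprob_algebra N) K)"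
    by (rule M.finite_measure_distr) measurable
  have "(\<integral>x. f x \<partial>(M \<bind> K)) = (\<integral>M'. (\<integral>x. f x \<partial>M') \<partial>distr M (subprob_algebra N) K)"
    unfolding bind_nonempty''[OF K' M.not_empty]
    by (rule integral_join[where B=B and B'=1])
       (auto simp: bdd fin AE_distr_iff subprob_space.emeasure_space_le_1
         dest!: measurable_space[OF K'] simp: space_subprob_algebra intro!: AE_I2)
  also have "\<dots> = (\<integral>x. (\<integral>t. f t \<partial>K x) \<partial>M)"
    by (rule integral_distr) measurable
  finally show ?thesis .
qed

section \<open>The Gibbs kernel of a positive joint density\<close>

text \<open>The common ground of both parametrisations. Positivity and \<open>fin_u\<close> make the
  law of U given theta a probability; positivity and \<open>fin_t\<close> do the same for Theta
  given U. Finiteness of the total mass is a separate hypothesis wherever the posterior has to be a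
  probability.\<close>

locale gibbs_density =
  fixes d :: "real^'p \<Rightarrow> real \<Rightarrow> real"
  assumes measurable_d [measurable]: "case_prod d \<in> borel_measurable (borel \<Otimes>\<^sub>M borel)"
    and d_pos: "\<And>u t. 0 < d u t"
    and fin_u: "\<And>t. (\<integral>\<^sup>+ u. ennreal (d u t) \<partial>lborel) < \<infinity>"
    and fin_t: "\<And>u. (\<integral>\<^sup>+ t. ennreal (d u t) \<partial>lborel) < \<infinity>"
begin

lemma measurable_d1 [measurable]: "d u \<in> borel_measurable borel"
  using measurable_compose[OF measurable_Pair1' measurable_d, of u] by simp

lemma measurable_d2 [measurable]: "(\<lambda>u. d u t) \<in> borel_measurable borel"
  using measurable_compose[OF measurable_Pair2' measurable_d, of t] by simp

definition update where "update u = normalise lborel (\<lambda>t. ennreal (d u t))"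

lemma measurable_update [measurable]: "update \<in> borel \<rightarrow>\<^sub>M prob_algebra borel"
proof (rule measurable_prob_algebraI)
  have prob: "prob_space (update u)" for u
    unfolding update_def using d_pos fin_t
    by (intro prob_space_normalise nn_integral_lborel_pos) auto
  then show "prob_space (update u)" for u .
  show "update \<in> borel \<rightarrow>\<^sub>M subprob_algebra borel"
  proof (rule measurable_subprob_algebra)
    show "subprob_space (update u)" for u
      by (rule prob_space_imp_subprob_space) (rule prob)
    show "sets (update u) = sets borel" for u
      by (simp add: update_def)
    fix A :: "real set" assume A [measurable]: "A \<in> sets borel"
    have "emeasure (update u) A = (\<integral>\<^sup>+ t. ennreal (d u t) * indicator A t \<partial>lborel) / (\<integral>\<^sup>+ t. ennreal (d u t) \<partial>lborel)" for u
      unfolding update_def by (subst nn_integral_normalise[symmetric]) auto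
    then show "(\<lambda>u. emeasure (update u) A) \<in> borel_measurable borel"
      by simp
  qed
qed

lemma measurable_update' [measurable]: "update \<in> borel \<rightarrow>\<^sub>M subprob_algebra borel"
  by (rule measurable_prob_algebraD) measurable

lemma gibbs_kernel_eq: "gibbs_kernel d t = normalise lborel (\<lambda>u. ennreal (d u t)) \<bind> update"
  by (simp add: gibbs_kernel_def update_def[abs_def])

lemma prob_space_conditional: "prob_space (normalise lborel (\<lambda>u. ennreal (d u t)))"
  using d_pos fin_u by (intro prob_space_normalise nn_integral_lborel_pos) auto

lemma sets_gibbs_kernel [simp, measurable_cong]: "sets (gibbs_kernel d t) = sets borel"
  unfolding gibbs_kernel_eq
  by (subst sets_bind_measurable[where B=borel]) (auto simp: measurable_update' cong: measurable_cong_sets)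

lemma nn_integral_gibbs_kernel:
  assumes [measurable]: "f \<in> borel_measurable borel"
  shows "(\<integral>\<^sup>+ s. f s \<partial>gibbs_kernel d t) =
    (\<integral>\<^sup>+ u. ennreal (d u t) * (\<integral>\<^sup>+ s. f s \<partial>update u) \<partial>lborel) / (\<integral>\<^sup>+ u. ennreal (d u t) \<partial>lborel)"
  unfolding gibbs_kernel_eq
  by (subst nn_integral_bind[where B=borel])
     (auto simp: nn_integral_normalise cong: measurable_cong_sets)

lemma measurable_gibbs_kernel [measurable]: "gibbs_kernel d \<in> borel \<rightarrow>\<^sub>M prob_algebra borel"
proof (rule measurable_prob_algebraI)
  have prob: "prob_space (gibbs_kernel d t)" for t
    unfolding gibbs_kernel_eq
    by (rule prob_space_bind'[where M=borel and N=borel])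
       (auto simp: space_prob_algebra prob_space_conditional)
  then show "prob_space (gibbs_kernel d t)" for t .
  show "gibbs_kernel d \<in> borel \<rightarrow>\<^sub>M subprob_algebra borel"
  proof (rule measurable_subprob_algebra)
    show "subprob_space (gibbs_kernel d u)" for u
      by (rule prob_space_imp_subprob_space) (rule prob)
    show "sets (gibbs_kernel d u) = sets borel" for u
      by simp
    fix A :: "real set" assume A [measurable]: "A \<in> sets borel"
    have "emeasure (gibbs_kernel d t) A =
      (\<integral>\<^sup>+ u. ennreal (d u t) * (\<integral>\<^sup>+ s. indicator A s \<partial>update u) \<partial>lborel) / (\<integral>\<^sup>+ u. ennreal (d u t) \<partial>lborel)" for t
      by (subst nn_integral_gibbs_kernel[symmetric]) auto
    then show "(\<lambda>u. emeasure (gibbs_kernel d u) A) \<in> borel_measurable borel"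
      by simp
  qed
qed

lemma measurable_gibbs_kernel' [measurable]: "gibbs_kernel d \<in> borel \<rightarrow>\<^sub>M subprob_algebra borel"
  by (rule measurable_prob_algebraD) measurable

lemma prob_space_gibbs_kernel: "prob_space (gibbs_kernel d t)"
  using measurable_space[OF measurable_gibbs_kernel] by (simp add: space_prob_algebra)

lemma gibbs_chain_in_space: "gibbs_chain d t n \<in> space (prob_algebra borel)"
proof (induction n)
  case 0
  then show ?case
    by (simp add: space_prob_algebra prob_space_return)
next
  case (Suc n)
  then show ?case
    using prob_space_bind'[OF Suc measurable_gibbs_kernel] sets_bind'[OF Suc measurable_gibbs_kernel]
    by (simp add: space_prob_algebra)
qed

lemma prob_space_gibbs_chain: "prob_space (gibbs_chain d t n)"
  and sets_gibbs_chain [simp, measurable_cong]: "sets (gibbs_chain d t n) = sets borel"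
  using gibbs_chain_in_space by (auto simp: space_prob_algebra)

section \<open>The Theta-marginal and its invariance\<close>

definition target where "target = normalise lborel (\<lambda>t. \<integral>\<^sup>+ u. ennreal (d u t) \<partial>lborel)"

lemma prob_space_target:
  assumes "(\<integral>\<^sup>+ t. \<integral>\<^sup>+ u. ennreal (d u t) \<partial>lborel \<partial>lborel) < \<infinity>"
  shows "prob_space target"
  unfolding target_def using d_pos assms
  by (intro prob_space_normalise nn_integral_lborel_pos) auto

lemma sets_target [simp, measurable_cong]: "sets target = sets borel"
  by (simp add: target_def)

text \<open>Weighting by the marginal \<open>?N t\<close> cancels the normalisation of U given
  theta, leaving the joint density. After exchanging the integrals, the mass \<open>?Z u\<close>
  cancels the normalisation of Theta given U, and a second exchange restores the marginal. Both
  cancellations need the constants to lie strictly between 0 and infinity.\<close>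

lemma target_invariant:
  "target \<bind> gibbs_kernel d = target"
proof (rule measure_eqI)
  show "sets (target \<bind> gibbs_kernel d) = sets target"
    by (subst sets_bind_measurable[where B=borel]) (auto simp: target_def cong: measurable_cong_sets)
  fix A assume "A \<in> sets (target \<bind> gibbs_kernel d)"
  then have A [measurable]: "A \<in> sets borel"
    by (subst (asm) sets_bind_measurable[where B=borel]) (auto simp: target_def cong: measurable_cong_sets)
  let ?N = "\<lambda>t. \<integral>\<^sup>+ u. ennreal (d u t) \<partial>lborel"
  let ?Z = "\<lambda>u. \<integral>\<^sup>+ t. ennreal (d u t) \<partial>lborel"
  let ?T = "\<integral>\<^sup>+ t. ?N t \<partial>lborel"
  have N: "0 < ?N t" "?N t < top" for t
    using d_pos fin_u by (auto intro!: nn_integral_lborel_pos)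
  have Z: "0 < ?Z u" "?Z u < top" for u
    using d_pos fin_t by (auto intro!: nn_integral_lborel_pos)
  have cancel: "a * (b / a) = b" if "0 < a" "a < top" for a b :: ennreal
    using that mult_divide_eq_ennreal[of a b] by (simp add: ennreal_times_divide mult.commute[of a])
  have upd: "emeasure (update u) A = (\<integral>\<^sup>+ t. ennreal (d u t) * indicator A t \<partial>lborel) / ?Z u" for u
    unfolding update_def by (subst nn_integral_normalise[symmetric]) auto
  have "emeasure (target \<bind> gibbs_kernel d) A = (\<integral>\<^sup>+ t. emeasure (gibbs_kernel d t) A \<partial>target)"
    by (rule emeasure_bind[where N=borel]) (auto simp: target_def cong: measurable_cong_sets)
  also have "\<dots> = (\<integral>\<^sup>+ t. ?N t * emeasure (gibbs_kernel d t) A \<partial>lborel) / ?T"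
    unfolding target_def by (rule nn_integral_normalise) measurable
  also have "(\<integral>\<^sup>+ t. ?N t * emeasure (gibbs_kernel d t) A \<partial>lborel) =
      (\<integral>\<^sup>+ t. \<integral>\<^sup>+ u. ennreal (d u t) * emeasure (update u) A \<partial>lborel \<partial>lborel)"
  proof (rule nn_integral_cong)
    fix t
    have "emeasure (gibbs_kernel d t) A = (\<integral>\<^sup>+ s. indicator A s \<partial>gibbs_kernel d t)"
      by simp
    also have "\<dots> = (\<integral>\<^sup>+ u. ennreal (d u t) * emeasure (update u) A \<partial>lborel) / ?N t"
      by (subst nn_integral_gibbs_kernel) (auto simp: update_def)
    finally show "?N t * emeasure (gibbs_kernel d t) A = (\<integral>\<^sup>+ u. ennreal (d u t) * emeasure (update u) A \<partial>lborel)"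
      using cancel[OF N] by simp
  qed
  also have "\<dots> = (\<integral>\<^sup>+ u. \<integral>\<^sup>+ t. ennreal (d u t) * emeasure (update u) A \<partial>lborel \<partial>lborel)"
    by (rule lborel_pair.Fubini') measurable
  also have "\<dots> = (\<integral>\<^sup>+ u. \<integral>\<^sup>+ t. ennreal (d u t) * indicator A t \<partial>lborel \<partial>lborel)"
  proof (rule nn_integral_cong)
    fix u
    show "(\<integral>\<^sup>+ t. ennreal (d u t) * emeasure (update u) A \<partial>lborel) = (\<integral>\<^sup>+ t. ennreal (d u t) * indicator A t \<partial>lborel)"
      using cancel[OF Z] by (subst nn_integral_multc) (auto simp: upd)
  qed
  also have "\<dots> = (\<integral>\<^sup>+ t. \<integral>\<^sup>+ u. ennreal (d u t) * indicator A t \<partial>lborel \<partial>lborel)"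
    by (rule lborel_pair.Fubini'[symmetric]) measurable
  also have "\<dots> = (\<integral>\<^sup>+ t. ?N t * indicator A t \<partial>lborel)"
    by (simp add: nn_integral_multc)
  also have "\<dots> / ?T = emeasure target A"
    unfolding target_def by (subst nn_integral_normalise[symmetric]) auto
  finally show "emeasure (target \<bind> gibbs_kernel d) A = emeasure target A" .
qed

end

section \<open>Doeblin minorisation and exponential drift\<close>

lemma prob_integrable_bounded:
  fixes f :: "real \<Rightarrow> real"
  assumes "prob_space M" "sets M = sets borel" "f \<in> borel_measurable borel" "\<And>x. a \<le> f x" "\<And>x. f x \<le> b"
  shows "integrable M f"
proof -
  interpret prob_space M by fact
  have "\<bar>f x\<bar> \<le> max \<bar>a\<bar> \<bar>b\<bar>" for x
    using assms(4,5)[of x] by linarith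
  then show ?thesis
    using assms(2,3) by (intro integrable_const_bound[where B="max \<bar>a\<bar> \<bar>b\<bar>"]) (auto cong: measurable_cong_sets)
qed

lemma tv_dist_le:
  assumes "\<And>A. A \<in> sets borel \<Longrightarrow> \<bar>measure M A - measure N A\<bar> \<le> c"
  shows "tv_dist M N \<le> c"
  unfolding tv_dist_def using assms by (intro cSUP_least) auto

text \<open>A real supremum dominates its members only if they are bounded above; differences of
  probabilities are bounded by 1.\<close>

lemma tv_dist_ge:
  assumes "prob_space M" "prob_space N" "A \<in> sets borel"
  shows "\<bar>measure M A - measure N A\<bar> \<le> tv_dist M N"
  unfolding tv_dist_def
proof (rule cSUP_upper)
  interpret M: prob_space M by fact
  interpret N: prob_space N by fact
  have "\<bar>measure M B - measure N B\<bar> \<le> 1" for B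
    using M.prob_le_1[of B] N.prob_le_1[of B] measure_nonneg[of M B] measure_nonneg[of N B] by linarith
  then show "bdd_above ((\<lambda>A. \<bar>measure M A - measure N A\<bar>) ` sets borel)"
    by (auto intro!: bdd_aboveI2[where M=1])
qed fact

lemma real_integral_minorized:
  fixes f :: "real \<Rightarrow> real"
  assumes M: "prob_space M" "sets M = sets borel" and N: "prob_space N" "sets N = sets borel"
    and minor: "\<And>g. g \<in> borel_measurable borel \<Longrightarrow> ennreal \<epsilon> * (\<integral>\<^sup>+ s. g s \<partial>N) \<le> (\<integral>\<^sup>+ s. g s \<partial>M)"
    and \<epsilon>: "0 \<le> \<epsilon>" and f: "f \<in> borel_measurable borel" "\<And>x. 0 \<le> f x" "\<And>x. f x \<le> b"
  shows "\<epsilon> * (\<integral>s. f s \<partial>N) \<le> (\<integral>s. f s \<partial>M)"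
proof -
  note int = prob_integrable_bounded[OF _ _ f]
  have "ennreal (\<epsilon> * (\<integral>s. f s \<partial>N)) \<le> ennreal (\<integral>s. f s \<partial>M)"
    using minor[of "\<lambda>s. ennreal (f s)"] f \<epsilon>
    by (simp add: nn_integral_eq_integral int[OF M] int[OF N] ennreal_mult)
  then show ?thesis
    using f by (simp add: ennreal_le_iff integral_nonneg)
qed

text \<open>Both geometric terms are at most multiples of \<open>\<rho> ^ n\<close> for one \<rho> <
  1, and a geometric sequence eventually falls below any reciprocal polynomial. This is the
  numerical contradiction behind the failure of the centred sampler.\<close>

lemma polynomial_not_le_geometric:
  fixes L c M r :: real
  assumes "0 \<le> r" "r < 1" "0 < c" "0 \<le> L" "0 < k"
  shows "\<exists>n::nat. M * r ^ n + (1/2) ^ n < c / (1 + (L * real n + 1)\<^sup>2) ^ k"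
proof -
  define \<rho> where "\<rho> = max r (1/2)"
  have \<rho>: "0 < \<rho>" "\<rho> < 1" "r \<le> \<rho>" "1/2 \<le> \<rho>"
    using assms by (auto simp: \<rho>_def)
  \<comment> \<open>The polynomial has degree 2k in n. Taking the root of that order reduces the
    claim to a linear factor times \<open>\<sigma> ^ n\<close> tending to 0.\<close>
  define \<sigma> where "\<sigma> = root (2 * k) \<rho>"
  have \<sigma>: "0 < \<sigma>" "\<sigma> < 1" "\<sigma> ^ (2 * k) = \<rho>"
    using \<rho> \<open>0 < k\<close> by (auto simp: \<sigma>_def)
  have "(\<lambda>n. L * (real n / (1 / \<sigma>) ^ n) + 2 * \<sigma> ^ n) \<longlonglongrightarrow> L * 0 + 2 * 0"
    using \<sigma> by (intro tendsto_add tendsto_mult_left lim_n_over_pown LIMSEQ_realpow_zero) auto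
  then have "(\<lambda>n. (L * real n + 2) * \<sigma> ^ n) \<longlonglongrightarrow> 0"
    by (simp add: power_divide distrib_right mult.assoc)
  from tendsto_mult_left[OF tendsto_power[OF this, of "2 * k"], of "\<bar>M\<bar> + 1"]
  have "(\<lambda>n. (\<bar>M\<bar> + 1) * ((L * real n + 2) * \<sigma> ^ n) ^ (2 * k)) \<longlonglongrightarrow> 0"
    using \<open>0 < k\<close> by (simp add: power_0_left)
  then have "\<forall>\<^sub>F n in sequentially. (\<bar>M\<bar> + 1) * ((L * real n + 2) * \<sigma> ^ n) ^ (2 * k) < c"
    using \<open>0 < c\<close> by (rule order_tendstoD)
  then obtain n where "(\<bar>M\<bar> + 1) * ((L * real n + 2) * \<sigma> ^ n) ^ (2 * k) < c"
    by (auto simp: eventually_sequentially)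
  moreover have "((L * real n + 2) * \<sigma> ^ n) ^ (2 * k) = \<rho> ^ n * ((L * real n + 2)\<^sup>2) ^ k"
    unfolding \<sigma>(3)[symmetric] by (simp add: power_mult_distrib power_mult[symmetric] mult.commute)
  ultimately have "(\<bar>M\<bar> + 1) * \<rho> ^ n * ((L * real n + 2)\<^sup>2) ^ k < c"
    by (simp add: mult.assoc)
  \<comment> \<open>Replacing the sum by a perfect square turns its k-th power into a 2k-th power,
    matching the root taken above.\<close>
  moreover have "1 + (L * real n + 1)\<^sup>2 \<le> (L * real n + 2)\<^sup>2"
    using \<open>0 \<le> L\<close> by (simp add: power2_eq_square algebra_simps)
  then have "(\<bar>M\<bar> + 1) * \<rho> ^ n * (1 + (L * real n + 1)\<^sup>2) ^ k \<le> (\<bar>M\<bar> + 1) * \<rho> ^ n * ((L * real n + 2)\<^sup>2) ^ k"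
    using \<rho> by (intro mult_left_mono power_mono) auto
  ultimately have n: "(\<bar>M\<bar> + 1) * \<rho> ^ n * (1 + (L * real n + 1)\<^sup>2) ^ k < c"
    by linarith
  have pos: "0 < (1 + (L * real n + 1)\<^sup>2) ^ k"
    by (intro zero_less_power add_pos_nonneg) auto
  have "M * r ^ n \<le> \<bar>M\<bar> * \<rho> ^ n"
    using \<rho> assms by (intro mult_mono power_mono) auto
  moreover have "(1/2) ^ n \<le> \<rho> ^ n"
    using \<rho> by (intro power_mono) auto
  ultimately have "M * r ^ n + (1/2) ^ n \<le> (\<bar>M\<bar> + 1) * \<rho> ^ n"
    by (simp add: algebra_simps)
  also have "\<dots> < c / (1 + (L * real n + 1)\<^sup>2) ^ k"
    using n pos by (simp add: pos_less_divide_eq)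
  finally show ?thesis by blast
qed

context gibbs_density
begin

text \<open>Statement and induction are over all f and all enclosing intervals [a, b], because the
  last transition replaces f by its conditional mean g, with values in an interval shorter by the
  factor 1 - \<epsilon>. Invariance allows the same replacement under the target.\<close>

lemma integral_chain_target_le:
  assumes total: "(\<integral>\<^sup>+ t. \<integral>\<^sup>+ u. ennreal (d u t) \<partial>lborel \<partial>lborel) < \<infinity>"
    and \<nu>: "prob_space \<nu>" "sets \<nu> = sets borel"
    and \<epsilon>: "0 \<le> \<epsilon>"
    and minor: "\<And>t g. g \<in> borel_measurable borel \<Longrightarrow>
      ennreal \<epsilon> * (\<integral>\<^sup>+ s. g s \<partial>\<nu>) \<le> (\<integral>\<^sup>+ s. g s \<partial>gibbs_kernel d t)"
    and "f \<in> borel_measurable borel" "\<And>x. a \<le> f x" "\<And>x. f x \<le> b"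
  shows "\<bar>(\<integral>x. f x \<partial>gibbs_chain d t0 n) - (\<integral>x. f x \<partial>target)\<bar> \<le> (1 - \<epsilon>) ^ n * (b - a)"
  using assms(6-8)
proof (induction n arbitrary: f a b)
  case (0 f a b)
  interpret T: prob_space target by (rule prob_space_target[OF total])
  note int = prob_integrable_bounded[OF T.prob_space_axioms sets_target 0]
  have "a \<le> (\<integral>x. f x \<partial>target)"
    using 0 int T.prob_space by (intro T.integral_ge_const) auto
  moreover have "(\<integral>x. f x \<partial>target) \<le> b"
    using 0 int T.prob_space by (intro T.integral_le_const) auto
  moreover have "(\<integral>x. f x \<partial>gibbs_chain d t0 0) = f t0"
    using 0 by (simp add: integral_return)
  ultimately show ?case
    using 0(2)[of t0] 0(3)[of t0] by (auto simp: abs_le_iff)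
next
  case (Suc n f a b)
  interpret \<nu>: prob_space \<nu> by fact
  interpret T: prob_space target by (rule prob_space_target[OF total])
  note [measurable] = Suc.prems(1)
  have fb: "\<bar>f x\<bar> \<le> max \<bar>a\<bar> \<bar>b\<bar>" for x
    using Suc.prems(2,3)[of x] by linarith
  define g where "g t = (\<integral>s. f s \<partial>gibbs_kernel d t)" for t
  define v where "v = (\<integral>s. f s \<partial>\<nu>)"
  have [measurable]: "g \<in> borel_measurable borel"
    unfolding g_def by measurable
  have int: "integrable \<nu> f"
    by (rule prob_integrable_bounded[OF \<nu> Suc.prems])
  \<comment> \<open>The minorisation is applied to the nonnegative functions f - a and b - f. The
    shift \<epsilon> v is the same at both ends and for every t, so it drops out of the length of
    the new interval.\<close>
  have lower: "(1 - \<epsilon>) * a + \<epsilon> * v \<le> g t" and upper: "g t \<le> (1 - \<epsilon>) * b + \<epsilon> * v" for t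
  proof -
    interpret K: prob_space "gibbs_kernel d t" by (rule prob_space_gibbs_kernel)
    have intK: "integrable (gibbs_kernel d t) f"
      by (rule prob_integrable_bounded[OF K.prob_space_axioms sets_gibbs_kernel Suc.prems])
    have "\<epsilon> * (\<integral>s. f s - a \<partial>\<nu>) \<le> (\<integral>s. f s - a \<partial>gibbs_kernel d t)"
      using Suc.prems
      by (intro real_integral_minorized[where b="b - a"] K.prob_space_axioms \<nu> minor \<epsilon>) auto
    then show "(1 - \<epsilon>) * a + \<epsilon> * v \<le> g t"
      using int intK by (simp add: g_def v_def \<nu>.prob_space K.prob_space algebra_simps)
    have "\<epsilon> * (\<integral>s. b - f s \<partial>\<nu>) \<le> (\<integral>s. b - f s \<partial>gibbs_kernel d t)"
      using Suc.prems
      by (intro real_integral_minorized[where b="b - a"] K.prob_space_axioms \<nu> minor \<epsilon>) auto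
    then show "g t \<le> (1 - \<epsilon>) * b + \<epsilon> * v"
      using int intK by (simp add: g_def v_def \<nu>.prob_space K.prob_space algebra_simps)
  qed
  have chain: "(\<integral>x. f x \<partial>gibbs_chain d t0 (Suc n)) = (\<integral>x. g x \<partial>gibbs_chain d t0 n)"
    unfolding g_def gibbs_chain.simps
    by (rule integral_bind_bounded[where N=borel and B="max \<bar>a\<bar> \<bar>b\<bar>"]) (auto simp: fb prob_space_gibbs_chain cong: measurable_cong_sets)
  have targ: "(\<integral>x. f x \<partial>target) = (\<integral>x. g x \<partial>target)"
    unfolding g_def
    by (subst target_invariant[symmetric], rule integral_bind_bounded[where N=borel and B="max \<bar>a\<bar> \<bar>b\<bar>"])
       (auto simp: fb T.prob_space_axioms cong: measurable_cong_sets)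
  have "\<bar>(\<integral>x. g x \<partial>gibbs_chain d t0 n) - (\<integral>x. g x \<partial>target)\<bar>
      \<le> (1 - \<epsilon>) ^ n * (((1 - \<epsilon>) * b + \<epsilon> * v) - ((1 - \<epsilon>) * a + \<epsilon> * v))"
    by (rule Suc.IH) (use lower upper in auto)
  then show ?case
    unfolding chain targ by (simp add: algebra_simps)
qed

text \<open>By \<open>minor\<close>, w lies below the density of U given theta for every theta.
  Pushing w through the Theta-update therefore gives a measure below every
  \<open>gibbs_kernel d t\<close>.\<close>

lemma uniformly_ergodicI:
  fixes w :: "real^'p \<Rightarrow> real"
  assumes total: "(\<integral>\<^sup>+ t. \<integral>\<^sup>+ u. ennreal (d u t) \<partial>lborel \<partial>lborel) < \<infinity>"
    and w [measurable]: "w \<in> borel_measurable borel" and w_pos: "\<And>u. 0 < w u"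
    and minor: "\<And>u t. ennreal (w u) * (\<integral>\<^sup>+ v. ennreal (d v t) \<partial>lborel) \<le> ennreal (d u t)"
  shows "uniformly_ergodic d target"
proof -
  interpret T: prob_space target by (rule prob_space_target[OF total])
  let ?N = "\<lambda>t. \<integral>\<^sup>+ v. ennreal (d v t) \<partial>lborel"
  have N: "0 < ?N t" "?N t < top" for t
    using d_pos fin_u by (auto intro!: nn_integral_lborel_pos)
  have minor': "ennreal (w u) * h \<le> ennreal (d u t) * h / ?N t" for u t h
  proof -
    have "ennreal (w u) = ennreal (w u) * ?N t / ?N t"
      using N[of t] by (simp add: mult_divide_eq_ennreal)
    also have "\<dots> \<le> ennreal (d u t) / ?N t"
      by (intro divide_right_mono_ennreal minor)
    finally show ?thesis
      using mult_right_mono[of "ennreal (w u)" "ennreal (d u t) / ?N t" h]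
      by (simp add: ennreal_times_divide mult.commute)
  qed
  have w_le: "(\<integral>\<^sup>+ u. ennreal (w u) * h u \<partial>lborel) \<le> (\<integral>\<^sup>+ u. ennreal (d u t) * h u \<partial>lborel) / ?N t"
    if [measurable]: "h \<in> borel_measurable borel" for h t
    by (subst nn_integral_divide[symmetric]) (auto intro!: nn_integral_mono minor')
  let ?W = "\<integral>\<^sup>+ u. ennreal (w u) \<partial>lborel"
  \<comment> \<open>Comparison with the conditional density of U at one value of theta; the choice 0
    is arbitrary.\<close>
  have W_le: "?W \<le> 1"
    using w_le[of "\<lambda>_. 1" 0] N[of 0] by (simp add: ennreal_divide_self)
  have W: "0 < ?W" "?W < top"
    using w_pos W_le by (auto intro!: nn_integral_lborel_pos intro: le_less_trans)
  define \<epsilon> where "\<epsilon> = enn2real ?W"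
  have \<epsilon>: "?W = ennreal \<epsilon>" "0 < \<epsilon>" "\<epsilon> \<le> 1"
    using W W_le by (auto simp: \<epsilon>_def enn2real_positive_iff enn2real_leI)
  \<comment> \<open>The regeneration law: U is drawn from w normalised and then updated as usual.
    The Doeblin constant \<epsilon> is the mass lost in that normalisation.\<close>
  define \<nu> where "\<nu> = normalise lborel (\<lambda>u. ennreal (w u)) \<bind> update"
  have \<nu>_space: "normalise lborel (\<lambda>u. ennreal (w u)) \<in> space (prob_algebra borel)"
    using W by (simp add: space_prob_algebra prob_space_normalise)
  have \<nu>: "prob_space \<nu>" "sets \<nu> = sets borel"
    unfolding \<nu>_def using prob_space_bind'[OF \<nu>_space measurable_update] sets_bind'[OF \<nu>_space measurable_update] by auto
  have doeblin: "ennreal \<epsilon> * (\<integral>\<^sup>+ s. g s \<partial>\<nu>) \<le> (\<integral>\<^sup>+ s. g s \<partial>gibbs_kernel d t)"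
    if [measurable]: "g \<in> borel_measurable borel" for g t
  proof -
    have "(\<integral>\<^sup>+ s. g s \<partial>\<nu>) = (\<integral>\<^sup>+ u. ennreal (w u) * (\<integral>\<^sup>+ s. g s \<partial>update u) \<partial>lborel) / ?W"
      unfolding \<nu>_def
      by (subst nn_integral_bind[where B=borel])
         (auto simp: nn_integral_normalise cong: measurable_cong_sets)
    then have "ennreal \<epsilon> * (\<integral>\<^sup>+ s. g s \<partial>\<nu>) = (\<integral>\<^sup>+ u. ennreal (w u) * (\<integral>\<^sup>+ s. g s \<partial>update u) \<partial>lborel)"
      using W mult_divide_eq_ennreal[of ?W] by (simp add: \<epsilon>(1)[symmetric] ennreal_times_divide mult.commute[of ?W])
    also have "\<dots> \<le> (\<integral>\<^sup>+ s. g s \<partial>gibbs_kernel d t)"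
      by (subst nn_integral_gibbs_kernel) (auto intro!: w_le)
    finally show ?thesis .
  qed
  have "tv_dist (gibbs_chain d t0 n) target \<le> 1 * (1 - \<epsilon>) ^ n" for t0 n
  proof (rule tv_dist_le)
    fix A :: "real set" assume [measurable]: "A \<in> sets borel"
    have "\<bar>(\<integral>x. indicator A x \<partial>gibbs_chain d t0 n) - (\<integral>x. indicator A x \<partial>target)\<bar> \<le> (1 - \<epsilon>) ^ n * (1 - 0)"
      using \<epsilon> by (intro integral_chain_target_le[OF total \<nu> _ doeblin]) (auto split: split_indicator)
    then show "\<bar>measure (gibbs_chain d t0 n) A - measure target A\<bar> \<le> 1 * (1 - \<epsilon>) ^ n"
      by (simp add: sets_eq_imp_space_eq[OF sets_gibbs_chain] sets_eq_imp_space_eq[OF sets_target])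
  qed
  then show ?thesis
    unfolding uniformly_ergodic_def using \<epsilon>
    by (intro exI[of _ "1 - \<epsilon>"] exI[of _ "\<lambda>_. 1"]) auto
qed

section \<open>Exponential drift against polynomial tails\<close>

lemma nn_integral_gibbs_chain_exp_le:
  assumes drift: "\<And>t. (\<integral>\<^sup>+ s. ennreal (exp \<bar>s\<bar>) \<partial>gibbs_kernel d t) \<le> ennreal (B * exp \<bar>t\<bar>)" and "0 \<le> B"
  shows "(\<integral>\<^sup>+ s. ennreal (exp \<bar>s\<bar>) \<partial>gibbs_chain d t n) \<le> ennreal (B ^ n * exp \<bar>t\<bar>)"
proof (induction n)
  case 0
  then show ?case
    by (simp add: nn_integral_return)
next
  case (Suc n)
  have "(\<integral>\<^sup>+ s. ennreal (exp \<bar>s\<bar>) \<partial>gibbs_chain d t (Suc n)) =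
      (\<integral>\<^sup>+ x. (\<integral>\<^sup>+ s. ennreal (exp \<bar>s\<bar>) \<partial>gibbs_kernel d x) \<partial>gibbs_chain d t n)"
    by (simp, rule nn_integral_bind[where B=borel]) (auto cong: measurable_cong_sets)
  also have "\<dots> \<le> (\<integral>\<^sup>+ x. ennreal B * ennreal (exp \<bar>x\<bar>) \<partial>gibbs_chain d t n)"
    using drift \<open>0 \<le> B\<close> by (intro nn_integral_mono) (simp add: ennreal_mult)
  also have "\<dots> = ennreal B * (\<integral>\<^sup>+ x. ennreal (exp \<bar>x\<bar>) \<partial>gibbs_chain d t n)"
    by (rule nn_integral_cmult) (simp cong: measurable_cong_sets)
  also have "\<dots> \<le> ennreal B * ennreal (B ^ n * exp \<bar>t\<bar>)"
    by (intro mult_left_mono Suc) auto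
  also have "\<dots> = ennreal (B ^ Suc n * exp \<bar>t\<bar>)"
    using \<open>0 \<le> B\<close> by (simp add: ennreal_mult[symmetric] mult.assoc)
  finally show ?case .
qed

text \<open>The half-lines [L n, \<infinity>) serve as test sets. The claimed bound is quantified
  over all starting points, so refuting it at 0 suffices, and there the initial mean of exp |theta|
  is 1.\<close>

lemma not_geometrically_ergodicI:
  assumes total: "(\<integral>\<^sup>+ t. \<integral>\<^sup>+ u. ennreal (d u t) \<partial>lborel \<partial>lborel) < \<infinity>"
    and drift: "\<And>t. (\<integral>\<^sup>+ s. ennreal (exp \<bar>s\<bar>) \<partial>gibbs_kernel d t) \<le> ennreal (B * exp \<bar>t\<bar>)"
    and "0 < B" "0 < c" "0 < k"
    and tail: "\<And>t. ennreal (c / (1 + t\<^sup>2) ^ k) \<le> (\<integral>\<^sup>+ u. ennreal (d u t) \<partial>lborel)"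
  shows "\<not> geometrically_ergodic d target"
proof
  assume "geometrically_ergodic d target"
  then obtain r M where r: "0 \<le> r" "r < 1"
    and geo: "\<And>t n. tv_dist (gibbs_chain d t n) target \<le> M t * r ^ n"
    unfolding geometrically_ergodic_def by blast
  interpret T: prob_space target by (rule prob_space_target[OF total])
  let ?N = "\<lambda>t. \<integral>\<^sup>+ v. ennreal (d v t) \<partial>lborel"
  define T where "T = enn2real (\<integral>\<^sup>+ t. ?N t \<partial>lborel)"
  have T': "0 < (\<integral>\<^sup>+ t. ?N t \<partial>lborel)"
    using d_pos by (auto intro!: nn_integral_lborel_pos)
  then have T: "0 < T" "(\<integral>\<^sup>+ t. ?N t \<partial>lborel) = ennreal T"
    using total by (auto simp: T_def enn2real_positive_iff)
  \<comment> \<open>Chosen so that B / exp L \<le> 1/2. The absolute value keeps L nonnegative when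
    2B < 1, so that the half-lines start at nonnegative points, where the tail bound
    decreases.\<close>
  define L where "L = \<bar>ln (2 * B)\<bar>"
  have L: "0 \<le> L" "2 * B \<le> exp L"
    using \<open>0 < B\<close> exp_le_cancel_iff[of "ln (2 * B)" "\<bar>ln (2 * B)\<bar>"] by (auto simp: L_def simp del: exp_le_cancel_iff)
  have chain_le: "measure (gibbs_chain d 0 n) {L * real n..} \<le> (1/2) ^ n" for n
  proof -
    interpret C: prob_space "gibbs_chain d 0 n" by (rule prob_space_gibbs_chain)
    have "emeasure (gibbs_chain d 0 n) {L * real n..} = (\<integral>\<^sup>+ s. indicator {L * real n..} s \<partial>gibbs_chain d 0 n)"
      by simp
    \<comment> \<open>Markov's inequality: on the event s \<ge> L n the factor exp (|s| - L n) is at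
      least 1.\<close>
    also have "\<dots> \<le> (\<integral>\<^sup>+ s. ennreal (exp (- L * real n)) * ennreal (exp \<bar>s\<bar>) \<partial>gibbs_chain d 0 n)"
      by (intro nn_integral_mono) (auto split: split_indicator simp: ennreal_mult[symmetric] exp_add[symmetric] simp flip: ennreal_1)
    also have "\<dots> = ennreal (exp (- L * real n)) * (\<integral>\<^sup>+ s. ennreal (exp \<bar>s\<bar>) \<partial>gibbs_chain d 0 n)"
      by (rule nn_integral_cmult) (simp cong: measurable_cong_sets)
    also have "\<dots> \<le> ennreal (exp (- L * real n)) * ennreal (B ^ n * exp \<bar>0\<bar>)"
      using \<open>0 < B\<close> by (intro mult_left_mono nn_integral_gibbs_chain_exp_le drift) auto
    also have "\<dots> = ennreal ((B / exp L) ^ n)"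
      using \<open>0 < B\<close> by (simp add: ennreal_mult[symmetric] exp_minus power_divide exp_of_nat_mult[symmetric] mult.commute field_simps)
    also have "\<dots> \<le> ennreal ((1/2) ^ n)"
      using L \<open>0 < B\<close> by (intro ennreal_leI power_mono) (auto simp: divide_le_eq)
    finally show ?thesis
      by (simp add: C.emeasure_eq_measure)
  qed
  have target_ge: "c / T / (1 + (L * real n + 1)\<^sup>2) ^ k \<le> measure target {L * real n..}" for n
  proof -
    \<comment> \<open>A piece of length 1 of the half-line is enough: there the tail bound is at
      least its value \<open>?c\<close> at the right endpoint, which is where the summand +1 comes
      from.\<close>
    let ?I = "{L * real n..L * real n + 1}"
    let ?c = "c / (1 + (L * real n + 1)\<^sup>2) ^ k"
    have "ennreal ?c = (\<integral>\<^sup>+ t. ennreal ?c * indicator ?I t \<partial>lborel)"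
      by (subst nn_integral_cmult_indicator) auto
    also have "\<dots> \<le> (\<integral>\<^sup>+ t. ?N t * indicator {L * real n..} t \<partial>lborel)"
    proof (rule nn_integral_mono)
      fix t :: real
      show "ennreal ?c * indicator ?I t \<le> ?N t * indicator {L * real n..} t"
      proof (cases "t \<in> ?I")
        case True
        have "0 \<le> t" using True L by (auto intro: order_trans[rotated])
        then have "c / (1 + (L * real n + 1)\<^sup>2) ^ k \<le> c / (1 + t\<^sup>2) ^ k"
          using True \<open>0 < c\<close> by (intro divide_left_mono power_mono add_mono mult_pos_pos zero_less_power) (auto intro: add_pos_nonneg)
        then have "ennreal ?c \<le> ?N t"
          using tail[of t] by (meson ennreal_leI order_trans)
        with True show ?thesis by auto
      qed auto
    qed
    finally have "ennreal ?c / ennreal T \<le> (\<integral>\<^sup>+ t. ?N t * indicator {L * real n..} t \<partial>lborel) / ennreal T"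
      by (rule divide_right_mono_ennreal)
    also have "\<dots> = emeasure target {L * real n..}"
      unfolding target_def T(2)[symmetric] by (subst nn_integral_normalise[symmetric]) auto
    finally have "ennreal (?c / T) \<le> emeasure target {L * real n..}"
      using \<open>0 < c\<close> T by (subst (asm) divide_ennreal) auto
    then show ?thesis
      by (simp add: T.emeasure_eq_measure mult.commute)
  qed
  obtain n where n: "M 0 * r ^ n + (1/2) ^ n < (c / T) / (1 + (L * real n + 1)\<^sup>2) ^ k"
    using polynomial_not_le_geometric[OF r, where k=k and c="c / T" and L=L and M="M 0"] \<open>0 < c\<close> \<open>0 < k\<close> T L by auto
  have "\<bar>measure (gibbs_chain d 0 n) {L * real n..} - measure target {L * real n..}\<bar> \<le> M 0 * r ^ n"
    by (rule order_trans[OF tv_dist_ge geo]) (auto intro: prob_space_gibbs_chain T.prob_space_axioms)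
  with chain_le[of n] target_ge[of n] n show False
    by linarith
qed

end

section \<open>Gaussian and Cauchy densities\<close>

lemma nn_integral_exp_square_finite:
  fixes c :: real assumes "0 < c"
  shows "(\<integral>\<^sup>+ x. ennreal (exp (- c * x\<^sup>2)) \<partial>lborel) < \<infinity>"
proof -
  \<comment> \<open>The standard deviation of the normal law whose exponent is
    \<open>- c * x\<^sup>2\<close>.\<close>
  define s where "s = 1 / sqrt (2 * c)"
  have s: "0 < s" "2 * s\<^sup>2 = 1 / c"
    using assms by (auto simp: s_def power_divide)
  have "(\<integral>\<^sup>+ x. ennreal (exp (- c * x\<^sup>2)) \<partial>lborel) =
      (\<integral>\<^sup>+ x. ennreal (sqrt (2 * pi * s\<^sup>2)) * ennreal (normal_density 0 s x) \<partial>lborel)"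
    using s assms by (intro nn_integral_cong) (simp add: normal_density_def ennreal_mult[symmetric] field_simps)
  also have "\<dots> = ennreal (sqrt (2 * pi * s\<^sup>2)) * (\<integral>\<^sup>+ x. ennreal (normal_density 0 s x) \<partial>lborel)"
    by (rule nn_integral_cmult) simp
  also have "(\<integral>\<^sup>+ x. ennreal (normal_density 0 s x) \<partial>lborel) = 1"
    using s(1) by (subst nn_integral_eq_integral) (auto simp: integral_normal_density)
  finally show ?thesis by (simp add: less_top)
qed

text \<open>Half of the quadratic term absorbs the linear one by completing the square; the other
  half is a product over coordinates, so the integral factorises.\<close>

lemma nn_integral_exp_norm_finite:
  fixes A c :: real assumes "0 < c"
  shows "(\<integral>\<^sup>+ x. ennreal (exp (A * norm x - c * (norm x)\<^sup>2)) \<partial>(lborel :: 'a::euclidean_space measure)) < \<infinity>"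
proof -
  have AM_GM: "A * r - c * r\<^sup>2 \<le> A\<^sup>2 / (2 * c) + - (c / 2) * r\<^sup>2" for r
  proof -
    have "0 \<le> (c * r - A)\<^sup>2 / (2 * c)"
      using assms by simp
    also have "\<dots> = A\<^sup>2 / (2 * c) + (c / 2) * r\<^sup>2 - A * r"
      using assms by (simp add: field_simps power2_eq_square)
    finally show ?thesis by simp
  qed
  have *: "exp (A * norm x - c * (norm x)\<^sup>2) \<le> exp (A\<^sup>2 / (2 * c)) * (\<Prod>b\<in>Basis. exp (- (c / 2) * (x \<bullet> b)\<^sup>2))" for x :: 'a
  proof -
    have "(norm x)\<^sup>2 = (\<Sum>b\<in>Basis. (x \<bullet> b)\<^sup>2)"
      unfolding power2_norm_eq_inner by (subst euclidean_inner) (simp add: power2_eq_square)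
    then have "(\<Prod>b\<in>Basis. exp (- (c / 2) * (x \<bullet> b)\<^sup>2)) = exp (- (c / 2) * (norm x)\<^sup>2)"
      by (simp add: exp_sum[symmetric] sum_distrib_left)
    then show ?thesis
      using AM_GM[of "norm x"] by (simp add: exp_add[symmetric])
  qed
  have "(\<integral>\<^sup>+ x. ennreal (exp (A * norm x - c * (norm x)\<^sup>2)) \<partial>(lborel :: 'a measure)) \<le>
      (\<integral>\<^sup>+ x. ennreal (exp (A\<^sup>2 / (2 * c))) * (\<Prod>b\<in>Basis. ennreal (exp (- (c / 2) * (x \<bullet> b)\<^sup>2))) \<partial>(lborel :: 'a measure))"
    using * by (intro nn_integral_mono) (simp add: prod_ennreal ennreal_mult[symmetric] prod_nonneg)
  also have "\<dots> = ennreal (exp (A\<^sup>2 / (2 * c))) * (\<Prod>b\<in>(Basis :: 'a set). \<integral>\<^sup>+ x. ennreal (exp (- (c / 2) * x\<^sup>2)) \<partial>lborel)"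
    by (subst nn_integral_cmult, measurable) (subst nn_integral_lborel_prod, auto)
  also have "\<dots> < \<infinity>"
    using nn_integral_exp_square_finite[of "c / 2"] assms
    by (auto simp: ennreal_mult_less_top power_less_top_ennreal)
  finally show ?thesis .
qed

section \<open>The Cauchy density and its shifts\<close>

lemma nn_integral_cauchy_dens_finite: "(\<integral>\<^sup>+ t. ennreal (cauchy_dens t) \<partial>lborel) < \<infinity>"
proof -
  have "integrable lborel (\<lambda>t::real. inverse (1 + t\<^sup>2))"
    using integrable_inverse_1_plus_square by (simp add: set_integrable_def)
  then have "integrable lborel (\<lambda>t::real. inverse (1 + t\<^sup>2) * (1 / pi))"
    by (intro integrable_mult_left)
  also have "(\<lambda>t::real. inverse (1 + t\<^sup>2) * (1 / pi)) = cauchy_dens"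
    by (simp add: fun_eq_iff cauchy_dens_def field_simps)
  finally have "integrable lborel cauchy_dens" .
  then show ?thesis
    by (subst nn_integral_eq_integral) (auto simp: cauchy_dens_def)
qed

lemma cauchy_dens_pos: "0 < cauchy_dens t"
  by (simp add: cauchy_dens_def add_pos_nonneg)

lemma cauchy_dens_le_1: "cauchy_dens t \<le> 1"
proof -
  have "1 * 1 \<le> pi * (1 + t\<^sup>2)"
    using pi_gt3 by (intro mult_mono) auto
  then show ?thesis
    by (simp add: cauchy_dens_def divide_le_eq_1)
qed

lemma cauchy_dens_shift_upper: "cauchy_dens (a - t) \<le> cauchy_dens t * (2 * (1 + a\<^sup>2))"
proof -
  \<comment> \<open>A sum-of-squares certificate: this expression is exactly the gap in \<open>1 +
    t\<^sup>2 \<le> 2 * (1 + a\<^sup>2) * (1 + (a - t)\<^sup>2)\<close>.\<close>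
  have "0 \<le> 1 + (2 * a - t)\<^sup>2 + 2 * (a * (a - t))\<^sup>2"
    by (intro add_nonneg_nonneg) auto
  also have "\<dots> = 2 * (1 + a\<^sup>2) * (1 + (a - t)\<^sup>2) - (1 + t\<^sup>2)"
    by (simp add: power2_eq_square algebra_simps)
  finally have "1 + t\<^sup>2 \<le> 2 * (1 + a\<^sup>2) * (1 + (a - t)\<^sup>2)"
    by simp
  moreover have "0 < 1 + t\<^sup>2" "0 < 1 + (a - t)\<^sup>2"
    by (simp_all add: add_pos_nonneg)
  ultimately have "1 / (1 + (a - t)\<^sup>2) \<le> (2 * (1 + a\<^sup>2)) / (1 + t\<^sup>2)"
    by (simp add: divide_le_eq le_divide_eq)
  from divide_right_mono[OF this, of pi] show ?thesis
    by (simp add: cauchy_dens_def mult.commute)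
qed

text \<open>The reflection t \<mapsto> a - t is an involution, so the upper bound read at a - t is
  the lower bound.\<close>

lemma cauchy_dens_shift_lower: "cauchy_dens t / (2 * (1 + a\<^sup>2)) \<le> cauchy_dens (a - t)"
proof -
  have "0 < 2 * (1 + a\<^sup>2)"
    by (simp add: add_pos_nonneg)
  then show ?thesis
    using cauchy_dens_shift_upper[of a "a - t"] by (simp add: pos_divide_le_eq)
qed

section \<open>Positive definite matrices\<close>

lemma posdef_imp_invertible:
  fixes S :: "real^'p^'p"
  assumes "\<And>v. v \<noteq> 0 \<Longrightarrow> 0 < v \<bullet> (S *v v)"
  shows "invertible S"
proof -
  have "x = 0" if "S *v x = 0" for x
    using assms[of x] that by fastforce
  then show ?thesis
    unfolding invertible_left_inverse matrix_left_invertible_ker by blast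
qed

lemma matrix_inv_right_invertible:
  fixes S :: "real^'p^'p"
  assumes "invertible S" shows "S ** matrix_inv S = mat 1"
  using assms unfolding invertible_def matrix_inv_def by (rule someI2_ex) simp

text \<open>The segment from the identity to S consists of positive definite, hence invertible,
  matrices. The determinant is continuous along it, starts at 1 and never vanishes, so it stays
  positive. This makes the Gaussian normaliser positive.\<close>

lemma posdef_imp_det_pos:
  fixes S :: "real^'p^'p"
  assumes S: "\<And>v. v \<noteq> 0 \<Longrightarrow> 0 < v \<bullet> (S *v v)"
  shows "0 < det S"
proof (rule ccontr)
  assume "\<not> 0 < det S"
  let ?M = "\<lambda>t::real. (1 - t) *\<^sub>R mat 1 + t *\<^sub>R S"
  have "continuous_on {0..1} (\<lambda>t. det (?M t))"
    unfolding det_def by (simp, intro continuous_intros)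
  then obtain t where t: "0 \<le> t" "t \<le> 1" "det (?M t) = 0"
    using IVT2'[of "\<lambda>t. det (?M t)" 1 0 0] \<open>\<not> 0 < det S\<close> by auto
  have "0 < v \<bullet> (?M t *v v)" if "v \<noteq> 0" for v
  proof -
    have "v \<bullet> (?M t *v v) = (1 - t) * (v \<bullet> v) + t * (v \<bullet> (S *v v))"
      by (simp add: matrix_vector_mult_add_rdistrib inner_add_right scaleR_matrix_vector_assoc[symmetric])
    also have "0 < \<dots>"
    proof (cases "t = 0")
      case False
      then show ?thesis
        using t S[OF that] by (intro add_nonneg_pos mult_nonneg_nonneg mult_pos_pos) auto
    qed (use that in auto)
    finally show ?thesis .
  qed
  then have "invertible (?M t)"
    by (rule posdef_imp_invertible)
  with t show False
    by (simp add: invertible_det_nz)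
qed

lemma transpose_matrix_inv:
  fixes S :: "real^'p^'p"
  assumes "invertible S" "transpose S = S"
  shows "transpose (matrix_inv S) = matrix_inv S"
proof -
  let ?Q = "matrix_inv S"
  have Q: "S ** ?Q = mat 1"
    using assms(1) by (rule matrix_inv_right_invertible)
  from arg_cong[OF this, of transpose] have "transpose ?Q ** S = mat 1"
    by (simp add: matrix_transpose_mul assms(2) transpose_mat)
  then have "(transpose ?Q ** S) ** ?Q = ?Q"
    by (simp only: matrix_mul_lid)
  then show ?thesis
    by (simp only: matrix_mul_assoc[symmetric] Q matrix_mul_rid)
qed

text \<open>The constant is the minimum of the quadratic form on the compact unit sphere, extended
  to all v by homogeneity.\<close>

lemma posdef_coercive:
  fixes Q :: "real^'p^'p"
  assumes Q: "\<And>v. v \<noteq> 0 \<Longrightarrow> 0 < v \<bullet> (Q *v v)"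
  shows "\<exists>c>0. \<forall>v. c * (norm v)\<^sup>2 \<le> v \<bullet> (Q *v v)"
proof -
  let ?q = "\<lambda>v. v \<bullet> (Q *v v)"
  have ne: "sphere 0 1 \<noteq> ({} :: (real^'p) set)"
    by simp
  have "continuous_on (sphere 0 1) ?q"
    by (intro continuous_on_inner continuous_on_id matrix_vector_mult_linear_continuous_on)
  from continuous_attains_inf[OF compact_sphere ne this]
  obtain w :: "real^'p" where w: "w \<in> sphere 0 1" "\<forall>v\<in>sphere 0 1. ?q w \<le> ?q v"
    by (rule bexE)
  have "?q w * (norm v)\<^sup>2 \<le> ?q v" for v
  proof (cases "v = 0")
    case False
    let ?u = "(1 / norm v) *\<^sub>R v"
    have "?u \<in> sphere 0 1"
      using False by simp
    then have "?q w \<le> ?q ?u"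
      by (rule bspec[OF w(2)])
    also have "?q ?u = ?q v / (norm v)\<^sup>2"
      by (simp add: matrix_vector_mult_scaleR power2_eq_square)
    finally show ?thesis
      using False by (simp add: pos_le_divide_eq)
  qed simp
  moreover have "0 < ?q w"
    using w(1) by (intro Q) auto
  ultimately show ?thesis
    by blast
qed

text \<open>With w the image of v under the inverse, the form at v equals w \<bullet> (S w), and w
  is nonzero because S w = v.\<close>

lemma posdef_matrix_inv:
  fixes S :: "real^'p^'p"
  assumes S: "\<And>v. v \<noteq> 0 \<Longrightarrow> 0 < v \<bullet> (S *v v)" and "v \<noteq> 0"
  shows "0 < v \<bullet> (matrix_inv S *v v)"
proof -
  let ?w = "matrix_inv S *v v"
  have "S *v ?w = v"
    using posdef_imp_invertible[OF S] by (simp add: matrix_vector_mul_assoc matrix_inv_right_invertible)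
  moreover from this have "?w \<noteq> 0"
    using \<open>v \<noteq> 0\<close> by auto
  ultimately show ?thesis
    using S[of ?w] by (simp add: inner_commute)
qed

text \<open>The polynomial rho of the overview: the product of the shift factors for a =
  \<open>y $ i - z $ i\<close>. The same factor serves above and below.\<close>

definition cauchy_ratio :: "real^'p \<Rightarrow> real^'p \<Rightarrow> real" where
  "cauchy_ratio y z = (\<Prod>i\<in>UNIV. 2 * (1 + (y $ i - z $ i)\<^sup>2))"

lemma cauchy_ratio_pos: "0 < cauchy_ratio y z"
  unfolding cauchy_ratio_def by (intro prod_pos) (simp add: add_pos_nonneg)

lemma cauchy_ratio_nonneg [simp]: "0 \<le> cauchy_ratio y z"
  by (rule less_imp_le[OF cauchy_ratio_pos])

lemma cauchy_dens_nonneg [simp]: "0 \<le> cauchy_dens t"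
  by (rule less_imp_le[OF cauchy_dens_pos])

lemma borel_measurable_cauchy_ratio [measurable]: "cauchy_ratio y \<in> borel_measurable borel"
  unfolding cauchy_ratio_def[abs_def] by measurable

lemma cauchy_prod_upper:
  "(\<Prod>i\<in>UNIV. cauchy_dens (y $ i - z $ i - t)) \<le> cauchy_dens t ^ CARD('p) * cauchy_ratio y z"
  for y z :: "real^'p"
proof -
  have "(\<Prod>i\<in>UNIV. cauchy_dens (y $ i - z $ i - t)) \<le> (\<Prod>i\<in>UNIV. cauchy_dens t * (2 * (1 + (y $ i - z $ i)\<^sup>2)))"
    by (intro prod_mono conjI cauchy_dens_shift_upper less_imp_le[OF cauchy_dens_pos])
  then show ?thesis
    by (simp only: prod.distrib prod_constant cauchy_ratio_def)
qed

lemma cauchy_prod_lower: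
  "cauchy_dens t ^ CARD('p) / cauchy_ratio y z \<le> (\<Prod>i\<in>UNIV. cauchy_dens (y $ i - z $ i - t))"
  for y z :: "real^'p"
proof -
  have "(\<Prod>i\<in>UNIV. cauchy_dens t / (2 * (1 + (y $ i - z $ i)\<^sup>2))) \<le> (\<Prod>i\<in>UNIV. cauchy_dens (y $ i - z $ i - t))"
    by (intro prod_mono conjI cauchy_dens_shift_lower divide_nonneg_nonneg less_imp_le[OF cauchy_dens_pos]) auto
  then show ?thesis
    by (simp only: prod_dividef prod_constant cauchy_ratio_def)
qed

text \<open>An exponential bound replaces polynomial moments: it merges with the other exponential
  weights in a single Gaussian integral.\<close>

lemma cauchy_ratio_exp_bound:
  fixes y :: "real^'p"
  shows "\<exists>C>0. \<forall>z. cauchy_ratio y z \<le> C * exp (real CARD('p) * norm z)"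
proof (intro exI conjI allI)
  let ?C = "\<Prod>i\<in>UNIV. 8 * (1 + (y $ i)\<^sup>2)"
  show "0 < ?C"
    by (intro prod_pos) (simp add: add_pos_nonneg)
  \<comment> \<open>The 8 is 4 times 2: the factor 4 separates a from b, and the factor 2 comes from
    \<open>1 + b\<^sup>2 \<le> 2 * exp r\<close>.\<close>
  have *: "2 * (1 + (a - b)\<^sup>2) \<le> 8 * (1 + a\<^sup>2) * exp r" if "\<bar>b\<bar> \<le> r" for a b r :: real
  proof -
    have "0 \<le> r" using that by simp
    have "1 + b\<^sup>2 \<le> 1 + r\<^sup>2"
      using that by (simp add: abs_le_square_iff[symmetric])
    also have "\<dots> \<le> 2 * (1 + r + r\<^sup>2 / 2)"
      using \<open>0 \<le> r\<close> by simp
    also have "\<dots> \<le> 2 * exp r"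
      using exp_lower_Taylor_quadratic[OF \<open>0 \<le> r\<close>] by simp
    finally have b: "1 + b\<^sup>2 \<le> 2 * exp r" .
    have "0 \<le> (1 + (a + b)\<^sup>2) + 2 * (a * b)\<^sup>2"
      by (intro add_nonneg_nonneg) auto
    then have "2 * (1 + (a - b)\<^sup>2) \<le> 4 * (1 + a\<^sup>2) * (1 + b\<^sup>2)"
      by (simp add: power2_eq_square algebra_simps)
    also have "\<dots> \<le> 4 * (1 + a\<^sup>2) * (2 * exp r)"
      by (intro mult_left_mono b) auto
    finally show ?thesis by (simp add: algebra_simps)
  qed
  fix z :: "real^'p"
  have "cauchy_ratio y z \<le> (\<Prod>i\<in>UNIV. 8 * (1 + (y $ i)\<^sup>2) * exp (norm z))"
    unfolding cauchy_ratio_def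
    by (intro prod_mono conjI * component_le_norm_cart) auto
  also have "\<dots> = ?C * exp (real CARD('p) * norm z)"
    by (simp only: prod.distrib prod_constant exp_of_nat_mult)
  finally show "cauchy_ratio y z \<le> ?C * exp (real CARD('p) * norm z)" .
qed

lemma borel_measurable_gauss_dens [measurable]: "gauss_dens S \<in> borel_measurable borel"
  unfolding gauss_dens_def[abs_def] divide_inverse[of "exp _"]
  by (intro borel_measurable_continuous_onI continuous_intros continuous_on_compose2[OF matrix_vector_mult_linear_continuous_on]) auto

lemma borel_measurable_cauchy_dens [measurable]: "cauchy_dens \<in> borel_measurable borel"
  unfolding cauchy_dens_def[abs_def] by measurable

text \<open>The exponent is at least 1 and the density at most 1, so the power lies below the
  integrable Cauchy density. This is what makes the posterior proper.\<close>

lemma cauchy_power_integral_finite: "(\<integral>\<^sup>+ t. ennreal (cauchy_dens t ^ CARD('p::finite)) \<partial>lborel) < \<infinity>"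
proof -
  have "cauchy_dens t ^ CARD('p) \<le> cauchy_dens t ^ 1" for t
    using cauchy_dens_pos[of t] cauchy_dens_le_1[of t] by (intro power_decreasing) (auto simp: Suc_le_eq)
  then have "(\<integral>\<^sup>+ t. ennreal (cauchy_dens t ^ CARD('p)) \<partial>lborel) \<le> (\<integral>\<^sup>+ t. ennreal (cauchy_dens t) \<partial>lborel)"
    by (intro nn_integral_mono ennreal_leI) simp
  then show ?thesis
    using nn_integral_cauchy_dens_finite by (rule le_less_trans)
qed

section \<open>Passing between the two parametrisations\<close>

lemma centred_dens_translate: "centred_dens S y (t *\<^sub>R ones + z) t = noncentred_dens S y z t"
  by (simp add: centred_dens_def noncentred_dens_def ones_def algebra_simps)

lemma measurable_centred_dens:
  "case_prod (centred_dens S y) \<in> borel_measurable (borel \<Otimes>\<^sub>M borel)" for S :: "real^'p^'p"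
proof -
  have [measurable]: "(\<lambda>p::(real^'p) \<times> real. fst p $ i) \<in> borel_measurable (borel \<Otimes>\<^sub>M borel)" for i
    by (rule measurable_compose[OF measurable_fst borel_measurable_nth])
  show ?thesis
    unfolding centred_dens_def case_prod_beta' by measurable
qed

lemma measurable_noncentred_dens:
  "case_prod (noncentred_dens S y) \<in> borel_measurable (borel \<Otimes>\<^sub>M borel)" for S :: "real^'p^'p"
proof -
  have [measurable]: "(\<lambda>p::(real^'p) \<times> real. fst p $ i) \<in> borel_measurable (borel \<Otimes>\<^sub>M borel)" for i
    by (rule measurable_compose[OF measurable_fst borel_measurable_nth])
  have [measurable]: "snd \<in> borel_measurable ((borel :: (real^'p) measure) \<Otimes>\<^sub>M (borel :: real measure))"
    by (rule measurable_snd)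
  show ?thesis
    unfolding noncentred_dens_def case_prod_beta' by measurable
qed

lemma measurable_centred_dens2 [measurable]: "(\<lambda>x. centred_dens S y x t) \<in> borel_measurable borel"
  unfolding centred_dens_def by measurable

lemma measurable_noncentred_dens2 [measurable]: "(\<lambda>x. noncentred_dens S y x t) \<in> borel_measurable borel"
  unfolding noncentred_dens_def by measurable

text \<open>Lebesgue measure is translation invariant, so the change of variables has no Jacobian:
  both samplers have the same Theta-marginal, and bounds proved for Xtilde transfer to X.\<close>

lemma nn_integral_centred_dens:
  "(\<integral>\<^sup>+ x. ennreal (centred_dens S y x t) \<partial>lborel) = (\<integral>\<^sup>+ z. ennreal (noncentred_dens S y z t) \<partial>lborel)"
  by (subst nn_integral_lborel_translate[where c="t *\<^sub>R ones"]) (simp_all add: centred_dens_translate)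

section \<open>The Cauchy-Gauss model\<close>

locale gauss_model =
  fixes S :: "real^'p^'p" and y :: "real^'p"
  assumes sym: "transpose S = S" and posdef: "\<And>v. v \<noteq> 0 \<Longrightarrow> 0 < v \<bullet> (S *v v)"
begin

lemma det_pos: "0 < det S"
  by (rule posdef_imp_det_pos) (rule posdef)

lemma gauss_dens_pos: "0 < gauss_dens S z"
  unfolding gauss_dens_def using det_pos by simp

lemma gauss_dens_nonneg [simp]: "0 \<le> gauss_dens S z"
  by (rule less_imp_le[OF gauss_dens_pos])

lemma noncentred_dens_pos: "0 < noncentred_dens S y z t"
  unfolding noncentred_dens_def by (intro mult_pos_pos gauss_dens_pos prod_pos cauchy_dens_pos)

lemma centred_dens_pos: "0 < centred_dens S y z t"
  unfolding centred_dens_def by (intro mult_pos_pos gauss_dens_pos prod_pos cauchy_dens_pos)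

lemma noncentred_dens_upper:
  "noncentred_dens S y z t \<le> cauchy_dens t ^ CARD('p) * (gauss_dens S z * cauchy_ratio y z)"
  unfolding noncentred_dens_def
  using mult_left_mono[OF cauchy_prod_upper less_imp_le[OF gauss_dens_pos]] by (simp add: mult_ac)

lemma noncentred_dens_lower:
  "cauchy_dens t ^ CARD('p) * (gauss_dens S z / cauchy_ratio y z) \<le> noncentred_dens S y z t"
  unfolding noncentred_dens_def
  using mult_left_mono[OF cauchy_prod_lower less_imp_le[OF gauss_dens_pos]] by (simp add: mult_ac)

text \<open>Coercivity of the inverse covariance gives a quadratic decay that beats both the growth
  of the ratio and the weight exp (k |z|). The weight is carried for the drift estimate, where it
  bounds the displacement of the conditional mean.\<close>

lemma gauss_cauchy_exp_integral_finite:
  "(\<integral>\<^sup>+ z. ennreal (gauss_dens S z * cauchy_ratio y z * exp (k * norm z)) \<partial>lborel) < \<infinity>"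
proof -
  have Q: "0 < v \<bullet> (matrix_inv S *v v)" if "v \<noteq> 0" for v
    by (rule posdef_matrix_inv[OF _ that]) (rule posdef)
  obtain c where c: "0 < c" "\<And>v. c * (norm v)\<^sup>2 \<le> v \<bullet> (matrix_inv S *v v)"
    using posdef_coercive[OF Q] by auto
  obtain C where C: "0 < C" "\<And>z. cauchy_ratio y z \<le> C * exp (real CARD('p) * norm z)"
    using cauchy_ratio_exp_bound[of y] by auto
  let ?D = "1 / sqrt ((2 * pi) ^ CARD('p) * det S)"
  let ?A = "real CARD('p) + k"
  have D: "0 < ?D"
    using det_pos by simp
  have "gauss_dens S z * cauchy_ratio y z * exp (k * norm z) \<le> (C * ?D) * exp (?A * norm z - c / 2 * (norm z)\<^sup>2)" for z
  proof -
    have "gauss_dens S z \<le> exp (- (c / 2 * (norm z)\<^sup>2)) * ?D"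
      using c(2)[of z] det_pos by (simp add: gauss_dens_def divide_right_mono)
    then have "gauss_dens S z * cauchy_ratio y z * exp (k * norm z) \<le>
        (exp (- (c / 2 * (norm z)\<^sup>2)) * ?D) * (C * exp (real CARD('p) * norm z)) * exp (k * norm z)"
      using C D gauss_dens_pos[of z] cauchy_ratio_pos[of y z] by (intro mult_mono) auto
    also have "\<dots> = (C * ?D) * exp (?A * norm z - c / 2 * (norm z)\<^sup>2)"
    proof -
      have "exp (?A * norm z - c / 2 * (norm z)\<^sup>2) =
          exp (- (c / 2 * (norm z)\<^sup>2)) * exp (real CARD('p) * norm z) * exp (k * norm z)"
        by (simp add: exp_add[symmetric] distrib_right)
      then show ?thesis
        by (simp only: mult_ac)
    qed
    finally show ?thesis .
  qed
  then have "(\<integral>\<^sup>+ z. ennreal (gauss_dens S z * cauchy_ratio y z * exp (k * norm z)) \<partial>lborel) \<le>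
     (\<integral>\<^sup>+ z. ennreal (C * ?D) * ennreal (exp (?A * norm z - c / 2 * (norm z)\<^sup>2)) \<partial>(lborel :: (real^'p) measure))"
    using C(1) D by (intro nn_integral_mono) (simp add: ennreal_mult[symmetric])
  also have "\<dots> = ennreal (C * ?D) * (\<integral>\<^sup>+ z. ennreal (exp (?A * norm z - c / 2 * (norm z)\<^sup>2)) \<partial>(lborel :: (real^'p) measure))"
    by (rule nn_integral_cmult) measurable
  also have "\<dots> < \<infinity>"
    using nn_integral_exp_norm_finite[of "c / 2" ?A, where 'a="real^'p"] c(1) by (auto simp: ennreal_mult_less_top)
  finally show ?thesis .
qed

section \<open>Bounds on the marginal density of theta\<close>

definition upper_mass :: "real \<Rightarrow> real" where
  "upper_mass k = enn2real (\<integral>\<^sup>+ z. ennreal (gauss_dens S z * cauchy_ratio y z * exp (k * norm z)) \<partial>lborel)"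

definition lower_mass :: real where
  "lower_mass = enn2real (\<integral>\<^sup>+ z. ennreal (gauss_dens S z / cauchy_ratio y z) \<partial>lborel)"

lemma upper_mass_eq: "(\<integral>\<^sup>+ z. ennreal (gauss_dens S z * cauchy_ratio y z * exp (k * norm z)) \<partial>lborel) = ennreal (upper_mass k)"
  unfolding upper_mass_def using gauss_cauchy_exp_integral_finite[of k] by simp

lemma upper_mass_pos: "0 < upper_mass k"
proof -
  have "0 < (\<integral>\<^sup>+ z. ennreal (gauss_dens S z * cauchy_ratio y z * exp (k * norm z)) \<partial>lborel)"
    by (rule nn_integral_lborel_pos) (auto simp: gauss_dens_pos cauchy_ratio_pos)
  then show ?thesis
    by (simp add: upper_mass_eq)
qed

lemma cauchy_ratio_ge_1: "1 \<le> cauchy_ratio y z"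
  unfolding cauchy_ratio_def by (rule prod_ge_1) (simp add: sum_power2_ge_zero add_increasing2)

lemma lower_mass_eq: "(\<integral>\<^sup>+ z. ennreal (gauss_dens S z / cauchy_ratio y z) \<partial>lborel) = ennreal lower_mass"
proof -
  \<comment> \<open>Since the ratio is at least 1, finiteness of the lower mass is inherited from
    the upper one; k = 0 makes the exponential weight trivial.\<close>
  have "gauss_dens S z / cauchy_ratio y z \<le> gauss_dens S z * cauchy_ratio y z" for z
  proof -
    have "1 * 1 \<le> cauchy_ratio y z * cauchy_ratio y z"
      using cauchy_ratio_ge_1[of z] by (intro mult_mono) auto
    then show ?thesis
      using gauss_dens_pos[of z] cauchy_ratio_pos[of y z]
      by (simp add: pos_divide_le_eq mult.assoc)
  qed
  then have "(\<integral>\<^sup>+ z. ennreal (gauss_dens S z / cauchy_ratio y z) \<partial>lborel) \<le>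
      (\<integral>\<^sup>+ z. ennreal (gauss_dens S z * cauchy_ratio y z * exp (0 * norm z)) \<partial>lborel)"
    by (intro nn_integral_mono ennreal_leI) simp
  also have "\<dots> = ennreal (upper_mass 0)"
    by (rule upper_mass_eq)
  also have "\<dots> < top"
    by simp
  finally show ?thesis
    unfolding lower_mass_def by simp
qed

lemma lower_mass_pos: "0 < lower_mass"
proof -
  have "0 < (\<integral>\<^sup>+ z. ennreal (gauss_dens S z / cauchy_ratio y z) \<partial>lborel)"
    by (rule nn_integral_lborel_pos) (auto simp: gauss_dens_pos cauchy_ratio_pos)
  then show ?thesis
    by (simp add: lower_mass_eq)
qed

lemma noncentred_exp_integral_upper:
  "(\<integral>\<^sup>+ z. ennreal (noncentred_dens S y z t * exp (k * norm z)) \<partial>lborel) \<le> ennreal (cauchy_dens t ^ CARD('p) * upper_mass k)"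
proof -
  have "noncentred_dens S y z t * exp (k * norm z) \<le>
     cauchy_dens t ^ CARD('p) * (gauss_dens S z * cauchy_ratio y z * exp (k * norm z))" for z
    using mult_right_mono[OF noncentred_dens_upper, of "exp (k * norm z)"] by (simp add: mult_ac)
  then have "(\<integral>\<^sup>+ z. ennreal (noncentred_dens S y z t * exp (k * norm z)) \<partial>lborel) \<le>
    (\<integral>\<^sup>+ z. ennreal (cauchy_dens t ^ CARD('p)) * ennreal (gauss_dens S z * cauchy_ratio y z * exp (k * norm z)) \<partial>lborel)"
    by (intro nn_integral_mono) (simp add: ennreal_mult'[symmetric])
  also have "\<dots> = ennreal (cauchy_dens t ^ CARD('p)) * ennreal (upper_mass k)"
    by (subst nn_integral_cmult) (auto simp: upper_mass_eq)
  finally show ?thesis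
    using cauchy_dens_pos[of t] upper_mass_pos by (simp add: ennreal_mult less_imp_le)
qed

lemma noncentred_integral_upper:
  "(\<integral>\<^sup>+ z. ennreal (noncentred_dens S y z t) \<partial>lborel) \<le> ennreal (cauchy_dens t ^ CARD('p) * upper_mass 0)"
  using noncentred_exp_integral_upper[of t 0] by simp

lemma noncentred_integral_lower:
  "ennreal (cauchy_dens t ^ CARD('p) * lower_mass) \<le> (\<integral>\<^sup>+ z. ennreal (noncentred_dens S y z t) \<partial>lborel)"
proof -
  have "ennreal (cauchy_dens t ^ CARD('p) * lower_mass) =
    (\<integral>\<^sup>+ z. ennreal (cauchy_dens t ^ CARD('p)) * ennreal (gauss_dens S z / cauchy_ratio y z) \<partial>lborel)"
    using cauchy_dens_pos[of t] lower_mass_pos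
    by (subst nn_integral_cmult) (auto simp: lower_mass_eq ennreal_mult less_imp_le)
  also have "\<dots> \<le> (\<integral>\<^sup>+ z. ennreal (noncentred_dens S y z t) \<partial>lborel)"
    by (intro nn_integral_mono, subst ennreal_mult'[symmetric]) (simp, rule ennreal_leI, rule noncentred_dens_lower)
  finally show ?thesis .
qed

lemma total_mass_finite:
  "(\<integral>\<^sup>+ t. \<integral>\<^sup>+ z. ennreal (noncentred_dens S y z t) \<partial>lborel \<partial>lborel) < \<infinity>"
proof -
  have "(\<integral>\<^sup>+ t. \<integral>\<^sup>+ z. ennreal (noncentred_dens S y z t) \<partial>lborel \<partial>lborel) \<le>
    (\<integral>\<^sup>+ t. ennreal (cauchy_dens t ^ CARD('p)) * ennreal (upper_mass 0) \<partial>lborel)"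
    using noncentred_integral_upper cauchy_dens_pos upper_mass_pos[of 0]
    by (intro nn_integral_mono) (simp add: ennreal_mult less_imp_le)
  also have "\<dots> < \<infinity>"
    using cauchy_power_integral_finite[where 'p='p] by (subst nn_integral_multc) (auto simp: ennreal_mult_less_top)
  finally show ?thesis .
qed

section \<open>The non-centred sampler\<close>

sublocale noncentred: gibbs_density "noncentred_dens S y"
proof
  show "(\<integral>\<^sup>+ u. ennreal (noncentred_dens S y u t) \<partial>lborel) < \<infinity>" for t
    using noncentred_integral_upper[of t] by (rule le_less_trans) simp
  show "(\<integral>\<^sup>+ t. ennreal (noncentred_dens S y u t) \<partial>lborel) < \<infinity>" for u
  proof -
    have "(\<integral>\<^sup>+ t. ennreal (noncentred_dens S y u t) \<partial>lborel) \<le>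
        (\<integral>\<^sup>+ t. ennreal (cauchy_dens t ^ CARD('p)) * ennreal (gauss_dens S u * cauchy_ratio y u) \<partial>lborel)"
      using noncentred_dens_upper[of u] cauchy_dens_pos gauss_dens_pos[of u] cauchy_ratio_pos[of y u]
      by (intro nn_integral_mono) (simp add: ennreal_mult[symmetric] less_imp_le)
    also have "\<dots> < \<infinity>"
      using cauchy_power_integral_finite[where 'p='p] by (subst nn_integral_multc) (auto simp: ennreal_mult_less_top)
    finally show ?thesis .
  qed
qed (simp_all add: measurable_noncentred_dens noncentred_dens_pos)

lemma noncentred_target: "noncentred.target = theta_posterior S y"
  by (simp add: noncentred.target_def theta_posterior_def nn_integral_centred_dens)

lemma uniformly_ergodic_noncentred: "uniformly_ergodic (noncentred_dens S y) (theta_posterior S y)"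
  unfolding noncentred_target[symmetric]
proof (rule noncentred.uniformly_ergodicI[OF total_mass_finite])
  \<comment> \<open>The lower bound of the joint density divided by the upper bound of its integral
    over u; the factor depending on t occurs in both and cancels.\<close>
  let ?w = "\<lambda>u. gauss_dens S u / cauchy_ratio y u / upper_mass 0"
  show "?w \<in> borel_measurable borel"
    by measurable
  show "0 < ?w u" for u
    by (intro divide_pos_pos gauss_dens_pos cauchy_ratio_pos upper_mass_pos)
  show "ennreal (?w u) * (\<integral>\<^sup>+ v. ennreal (noncentred_dens S y v t) \<partial>lborel) \<le> ennreal (noncentred_dens S y u t)" for u t
  proof -
    have "ennreal (?w u) * (\<integral>\<^sup>+ v. ennreal (noncentred_dens S y v t) \<partial>lborel) \<le>
       ennreal (?w u) * ennreal (cauchy_dens t ^ CARD('p) * upper_mass 0)"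
      by (intro mult_left_mono noncentred_integral_upper) auto
    also have "\<dots> = ennreal (cauchy_dens t ^ CARD('p) * (gauss_dens S u / cauchy_ratio y u))"
      using cauchy_dens_pos[of t] upper_mass_pos[of 0] gauss_dens_pos[of u] cauchy_ratio_pos[of y u]
      by (simp add: ennreal_mult[symmetric] less_imp_le)
    also have "\<dots> \<le> ennreal (noncentred_dens S y u t)"
      by (intro ennreal_leI noncentred_dens_lower)
    finally show ?thesis .
  qed
qed

section \<open>The Gaussian law of Theta given X\<close>

definition precision :: real where
  "precision = ones \<bullet> (matrix_inv S *v ones)"

text \<open>The generalised least squares estimate of theta from x. Under the flat prior, Theta
  given X = x is normal with this mean and with variance 1 / \<open>precision\<close>, which does
  not depend on x.\<close>

definition post_mean :: "real^'p \<Rightarrow> real" where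
  "post_mean x = x \<bullet> (matrix_inv S *v ones) / precision"

lemma precision_pos: "0 < precision"
proof -
  have "(ones :: real^'p) \<noteq> 0"
    by (simp add: ones_def vec_eq_iff)
  then show ?thesis
    unfolding precision_def by (intro posdef_matrix_inv posdef)
qed

text \<open>Completing the square in s. Symmetry of the inverse covariance merges the two cross
  terms, and \<open>post_mean x\<close> is the vertex of the resulting parabola.\<close>

lemma gauss_dens_shift:
  "gauss_dens S (x - s *\<^sub>R ones) = gauss_dens S (x - post_mean x *\<^sub>R ones) * exp (- (precision / 2) * (s - post_mean x)\<^sup>2)"
proof -
  let ?Q = "matrix_inv S"
  let ?q = "\<lambda>v. v \<bullet> (?Q *v v)"
  let ?b = "x \<bullet> (?Q *v ones)"
  have "invertible S"
    by (rule posdef_imp_invertible) (rule posdef)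
  then have "transpose ?Q = ?Q"
    using sym by (rule transpose_matrix_inv)
  then have "ones \<bullet> (?Q *v x) = ?b"
    by (metis dot_lmul_matrix inner_commute transpose_matrix_vector)
  then have q: "?q (x - r *\<^sub>R ones) = ?q x - 2 * r * ?b + r\<^sup>2 * precision" for r
    by (simp add: precision_def matrix_vector_mult_diff_distrib matrix_vector_mult_scaleR inner_diff_left inner_diff_right
        power2_eq_square algebra_simps)
  have b: "?b = precision * post_mean x"
    using precision_pos by (simp add: post_mean_def)
  have "- ?q (x - s *\<^sub>R ones) / 2 = - ?q (x - post_mean x *\<^sub>R ones) / 2 + - (precision / 2) * (s - post_mean x)\<^sup>2"
    unfolding q b by (simp add: power2_eq_square field_simps)
  then show ?thesis
    unfolding gauss_dens_def by (simp only: exp_add times_divide_eq_left)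
qed

definition centred_factor :: "real^'p \<Rightarrow> real" where
  "centred_factor x = gauss_dens S (x - post_mean x *\<^sub>R ones) * (\<Prod>i\<in>UNIV. cauchy_dens (y $ i - x $ i))"

lemma centred_factor_pos: "0 < centred_factor x"
  unfolding centred_factor_def by (intro mult_pos_pos gauss_dens_pos prod_pos cauchy_dens_pos)

lemma centred_dens_factor:
  "centred_dens S y x s = centred_factor x * exp (- (precision / 2) * (s - post_mean x)\<^sup>2)"
  unfolding centred_dens_def centred_factor_def gauss_dens_shift[of x s] by (simp only: mult_ac)

text \<open>For a = 0 this is the normaliser of the centred Theta-update, for a = 1 the numerator in
  its mean of exp |s|. After recentring at the conditional mean neither depends on x.\<close>

definition exp_mass :: "real \<Rightarrow> real" where
  "exp_mass a = enn2real (\<integral>\<^sup>+ s. ennreal (exp (a * \<bar>s\<bar> - precision / 2 * s\<^sup>2)) \<partial>lborel)"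

lemma exp_mass_eq: "(\<integral>\<^sup>+ s. ennreal (exp (a * \<bar>s\<bar> - precision / 2 * s\<^sup>2)) \<partial>lborel) = ennreal (exp_mass a)"
  unfolding exp_mass_def
  using nn_integral_exp_norm_finite[of "precision / 2" a, where 'a=real] precision_pos by simp

lemma exp_mass_pos: "0 < exp_mass a"
proof -
  have "0 < (\<integral>\<^sup>+ s. ennreal (exp (a * \<bar>s\<bar> - precision / 2 * s\<^sup>2)) \<partial>lborel)"
    by (rule nn_integral_lborel_pos) auto
  then show ?thesis
    unfolding exp_mass_eq by simp
qed

lemma nn_integral_centred_dens_t:
  "(\<integral>\<^sup>+ s. ennreal (centred_dens S y x s) \<partial>lborel) = ennreal (centred_factor x * exp_mass 0)"
proof -
  have "(\<integral>\<^sup>+ s. ennreal (centred_dens S y x s) \<partial>lborel) =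
      (\<integral>\<^sup>+ s. ennreal (centred_factor x * exp (- (precision / 2) * s\<^sup>2)) \<partial>lborel)"
    unfolding centred_dens_factor
    by (subst nn_integral_lborel_translate[where c="post_mean x"]) auto
  also have "\<dots> = (\<integral>\<^sup>+ s. ennreal (centred_factor x) * ennreal (exp (0 * \<bar>s\<bar> - precision / 2 * s\<^sup>2)) \<partial>lborel)"
    using centred_factor_pos[of x] by (intro nn_integral_cong) (simp add: ennreal_mult' less_imp_le)
  also have "\<dots> = ennreal (centred_factor x) * ennreal (exp_mass 0)"
    by (subst nn_integral_cmult, measurable) (simp only: exp_mass_eq)
  finally show ?thesis
    using centred_factor_pos[of x] by (simp add: ennreal_mult' less_imp_le)
qed

lemma nn_integral_centred_dens_exp:
  "(\<integral>\<^sup>+ s. ennreal (centred_dens S y x s) * ennreal (exp \<bar>s\<bar>) \<partial>lborel)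
    \<le> ennreal (centred_factor x * exp \<bar>post_mean x\<bar> * exp_mass 1)"
proof -
  let ?m = "post_mean x"
  have "(\<integral>\<^sup>+ s. ennreal (centred_dens S y x s) * ennreal (exp \<bar>s\<bar>) \<partial>lborel) =
      (\<integral>\<^sup>+ s. ennreal (centred_factor x * exp (- (precision / 2) * s\<^sup>2)) * ennreal (exp \<bar>?m + s\<bar>) \<partial>lborel)"
    unfolding centred_dens_factor
    by (subst nn_integral_lborel_translate[where c="?m"]) auto
  also have "\<dots> \<le> (\<integral>\<^sup>+ s. ennreal (centred_factor x * exp \<bar>?m\<bar>) * ennreal (exp (1 * \<bar>s\<bar> - precision / 2 * s\<^sup>2)) \<partial>lborel)"
  proof (rule nn_integral_mono)
    fix s :: real
    have "exp \<bar>?m + s\<bar> \<le> exp \<bar>?m\<bar> * exp \<bar>s\<bar>"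
      by (simp add: exp_add[symmetric])
    then have "centred_factor x * exp (- (precision / 2) * s\<^sup>2) * exp \<bar>?m + s\<bar> \<le>
        centred_factor x * exp (- (precision / 2) * s\<^sup>2) * (exp \<bar>?m\<bar> * exp \<bar>s\<bar>)"
      using centred_factor_pos[of x] by (intro mult_left_mono) (auto simp: less_imp_le)
    also have "\<dots> = centred_factor x * exp \<bar>?m\<bar> * exp (1 * \<bar>s\<bar> - precision / 2 * s\<^sup>2)"
    proof -
      have "exp (1 * \<bar>s\<bar> - precision / 2 * s\<^sup>2) = exp (- (precision / 2) * s\<^sup>2) * exp \<bar>s\<bar>"
        by (simp add: exp_add[symmetric])
      then show ?thesis
        by (simp only: mult_ac)
    qed
    finally show "ennreal (centred_factor x * exp (- (precision / 2) * s\<^sup>2)) * ennreal (exp \<bar>?m + s\<bar>) \<le>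
        ennreal (centred_factor x * exp \<bar>?m\<bar>) * ennreal (exp (1 * \<bar>s\<bar> - precision / 2 * s\<^sup>2))"
      using centred_factor_pos[of x]
      by (subst (1 2) ennreal_mult''[symmetric]) (auto intro: ennreal_leI)
  qed
  also have "\<dots> = ennreal (centred_factor x * exp \<bar>?m\<bar>) * ennreal (exp_mass 1)"
    by (subst nn_integral_cmult, measurable) (simp only: exp_mass_eq)
  finally show ?thesis
    using exp_mass_pos[of 1] by (simp add: ennreal_mult'' less_imp_le)
qed

section \<open>The centred sampler\<close>

sublocale centred: gibbs_density "centred_dens S y"
proof
  show "(\<integral>\<^sup>+ u. ennreal (centred_dens S y u t) \<partial>lborel) < \<infinity>" for t
    using noncentred.fin_u by (simp add: nn_integral_centred_dens)
  show "(\<integral>\<^sup>+ t. ennreal (centred_dens S y u t) \<partial>lborel) < \<infinity>" for u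
    by (simp add: nn_integral_centred_dens_t)
qed (simp_all add: measurable_centred_dens centred_dens_pos)

lemma centred_target: "centred.target = theta_posterior S y"
  by (simp add: centred.target_def theta_posterior_def)

lemma centred_update_exp:
  "(\<integral>\<^sup>+ s. ennreal (exp \<bar>s\<bar>) \<partial>centred.update x) \<le> ennreal (exp_mass 1 / exp_mass 0 * exp \<bar>post_mean x\<bar>)"
proof -
  have "(\<integral>\<^sup>+ s. ennreal (exp \<bar>s\<bar>) \<partial>centred.update x) =
      (\<integral>\<^sup>+ s. ennreal (centred_dens S y x s) * ennreal (exp \<bar>s\<bar>) \<partial>lborel) / ennreal (centred_factor x * exp_mass 0)"
    unfolding centred.update_def nn_integral_centred_dens_t[symmetric]
    by (rule nn_integral_normalise) measurable
  also have "\<dots> \<le> ennreal (centred_factor x * exp \<bar>post_mean x\<bar> * exp_mass 1) / ennreal (centred_factor x * exp_mass 0)"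
    by (intro divide_right_mono_ennreal nn_integral_centred_dens_exp)
  also have "\<dots> = ennreal (exp_mass 1 / exp_mass 0 * exp \<bar>post_mean x\<bar>)"
    using centred_factor_pos[of x] exp_mass_pos[of 0] exp_mass_pos[of 1]
    by (subst divide_ennreal) (auto simp: mult_ac)
  finally show ?thesis .
qed

text \<open>The conditional mean is linear in x and equals 1 at \<open>ones\<close>; Cauchy-Schwarz
  bounds the part coming from z. That |t| has coefficient exactly 1 is essential: one sweep then
  multiplies exp |t| by a constant instead of raising it to a power.\<close>

lemma post_mean_translate_le:
  "\<exists>k. \<forall>t z. \<bar>post_mean (t *\<^sub>R ones + z)\<bar> \<le> \<bar>t\<bar> + k * norm z"
proof (intro exI allI)
  fix t z
  let ?w = "matrix_inv S *v (ones :: real^'p)"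
  have "post_mean (t *\<^sub>R ones + z) = t + (z \<bullet> ?w) / precision"
    using precision_pos by (simp add: post_mean_def precision_def inner_add_left add_divide_distrib)
  also have "\<bar>\<dots>\<bar> \<le> \<bar>t\<bar> + \<bar>z \<bullet> ?w\<bar> / precision"
    using precision_pos abs_triangle_ineq[of t "(z \<bullet> ?w) / precision"] by (simp add: abs_divide)
  also have "\<bar>z \<bullet> ?w\<bar> / precision \<le> norm z * norm ?w / precision"
    using precision_pos by (intro divide_right_mono Cauchy_Schwarz_ineq2) simp
  finally show "\<bar>post_mean (t *\<^sub>R ones + z)\<bar> \<le> \<bar>t\<bar> + norm ?w / precision * norm z"
    by (simp add: mult.commute)
qed

lemma centred_drift:
  "\<exists>B>0. \<forall>t. (\<integral>\<^sup>+ s. ennreal (exp \<bar>s\<bar>) \<partial>gibbs_kernel (centred_dens S y) t) \<le> ennreal (B * exp \<bar>t\<bar>)"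
proof -
  obtain k where k: "\<And>t z. \<bar>post_mean (t *\<^sub>R ones + z)\<bar> \<le> \<bar>t\<bar> + k * norm z"
    using post_mean_translate_le by auto
  let ?G = "exp_mass 1 / exp_mass 0"
  \<comment> \<open>\<open>?G\<close> is the cost of the Gaussian Theta-update; the quotient of
    masses bounds the mean of exp (k |z|) under the law of X - t \<open>ones\<close> given theta =
    t, uniformly in t because the Cauchy power cancels.\<close>
  let ?B = "?G * upper_mass k / lower_mass"
  have G: "0 < ?G"
    by (intro divide_pos_pos exp_mass_pos)
  have "(\<integral>\<^sup>+ s. ennreal (exp \<bar>s\<bar>) \<partial>gibbs_kernel (centred_dens S y) t) \<le> ennreal (?B * exp \<bar>t\<bar>)" for t
  proof -
    let ?\<kappa> = "cauchy_dens t ^ CARD('p)"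
    let ?N = "\<integral>\<^sup>+ x. ennreal (centred_dens S y x t) \<partial>lborel"
    have \<kappa>: "0 < ?\<kappa>"
      by (intro zero_less_power cauchy_dens_pos)
    have N: "ennreal (?\<kappa> * lower_mass) \<le> ?N"
      unfolding nn_integral_centred_dens by (rule noncentred_integral_lower)
    have "(\<integral>\<^sup>+ x. ennreal (centred_dens S y x t) * (\<integral>\<^sup>+ s. ennreal (exp \<bar>s\<bar>) \<partial>centred.update x) \<partial>lborel)
      = (\<integral>\<^sup>+ z. ennreal (noncentred_dens S y z t) * (\<integral>\<^sup>+ s. ennreal (exp \<bar>s\<bar>) \<partial>centred.update (t *\<^sub>R ones + z)) \<partial>lborel)"
      by (subst nn_integral_lborel_translate[where c="t *\<^sub>R ones"]) (simp_all add: centred_dens_translate)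
    also have "\<dots> \<le> (\<integral>\<^sup>+ z. ennreal (?G * exp \<bar>t\<bar>) * ennreal (noncentred_dens S y z t * exp (k * norm z)) \<partial>lborel)"
    proof (rule nn_integral_mono)
      fix z
      have "(\<integral>\<^sup>+ s. ennreal (exp \<bar>s\<bar>) \<partial>centred.update (t *\<^sub>R ones + z)) \<le> ennreal (?G * exp (\<bar>t\<bar> + k * norm z))"
        using G by (intro order_trans[OF centred_update_exp] ennreal_leI mult_left_mono) (use k in auto)
      then have "ennreal (noncentred_dens S y z t) * (\<integral>\<^sup>+ s. ennreal (exp \<bar>s\<bar>) \<partial>centred.update (t *\<^sub>R ones + z)) \<le>
          ennreal (noncentred_dens S y z t) * ennreal (?G * exp (\<bar>t\<bar> + k * norm z))"
        by (intro mult_left_mono) auto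
      also have "\<dots> = ennreal (noncentred_dens S y z t * (?G * exp (\<bar>t\<bar> + k * norm z)))"
        using noncentred_dens_pos[of z t] by (intro ennreal_mult'[symmetric]) (rule less_imp_le)
      also have "\<dots> = ennreal (?G * exp \<bar>t\<bar> * (noncentred_dens S y z t * exp (k * norm z)))"
        by (simp add: exp_add mult_ac)
      also have "\<dots> = ennreal (?G * exp \<bar>t\<bar>) * ennreal (noncentred_dens S y z t * exp (k * norm z))"
        by (intro ennreal_mult' mult_nonneg_nonneg less_imp_le[OF G]) simp
      finally show "ennreal (noncentred_dens S y z t) * (\<integral>\<^sup>+ s. ennreal (exp \<bar>s\<bar>) \<partial>centred.update (t *\<^sub>R ones + z)) \<le>
         ennreal (?G * exp \<bar>t\<bar>) * ennreal (noncentred_dens S y z t * exp (k * norm z))" .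
    qed
    also have "\<dots> = ennreal (?G * exp \<bar>t\<bar>) * (\<integral>\<^sup>+ z. ennreal (noncentred_dens S y z t * exp (k * norm z)) \<partial>lborel)"
      by (rule nn_integral_cmult) measurable
    also have "\<dots> \<le> ennreal (?G * exp \<bar>t\<bar>) * ennreal (?\<kappa> * upper_mass k)"
      by (intro mult_left_mono noncentred_exp_integral_upper) simp
    also have "\<dots> = ennreal (?G * exp \<bar>t\<bar> * (?\<kappa> * upper_mass k))"
      by (intro ennreal_mult'[symmetric] mult_nonneg_nonneg less_imp_le[OF G]) simp
    also have "\<dots> = ennreal (?\<kappa> * lower_mass * (?B * exp \<bar>t\<bar>))"
      using lower_mass_pos by (simp add: mult_ac)
    also have "\<dots> = ennreal (?\<kappa> * lower_mass) * ennreal (?B * exp \<bar>t\<bar>)"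
      using lower_mass_pos \<kappa> by (intro ennreal_mult') simp
    also have "\<dots> \<le> ?N * ennreal (?B * exp \<bar>t\<bar>)"
      by (intro mult_right_mono N) simp
    finally have "(\<integral>\<^sup>+ x. ennreal (centred_dens S y x t) * (\<integral>\<^sup>+ s. ennreal (exp \<bar>s\<bar>) \<partial>centred.update x) \<partial>lborel)
        \<le> ?N * ennreal (?B * exp \<bar>t\<bar>)" .
    moreover have "0 < ?N"
      using N \<kappa> lower_mass_pos by (intro less_le_trans[OF _ N]) simp
    ultimately show ?thesis
      by (subst centred.nn_integral_gibbs_kernel) (auto intro: divide_le_posI_ennreal)
  qed
  moreover have "0 < ?B"
    by (intro divide_pos_pos mult_pos_pos exp_mass_pos upper_mass_pos lower_mass_pos)
  ultimately show ?thesis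
    by blast
qed

lemma not_geometrically_ergodic_centred: "\<not> geometrically_ergodic (centred_dens S y) (theta_posterior S y)"
proof -
  obtain B where B: "0 < B"
    "\<And>t. (\<integral>\<^sup>+ s. ennreal (exp \<bar>s\<bar>) \<partial>gibbs_kernel (centred_dens S y) t) \<le> ennreal (B * exp \<bar>t\<bar>)"
    using centred_drift by auto
  \<comment> \<open>The lower bound on the marginal with the Cauchy power written out, so that c =
    \<open>lower_mass / pi ^ CARD('p)\<close> and k = \<open>CARD('p)\<close> in the general
    criterion.\<close>
  have tail: "ennreal (lower_mass / pi ^ CARD('p) / (1 + t\<^sup>2) ^ CARD('p)) \<le> (\<integral>\<^sup>+ x. ennreal (centred_dens S y x t) \<partial>lborel)" for t
    using noncentred_integral_lower[of t]
    by (simp add: nn_integral_centred_dens cauchy_dens_def power_divide power_mult_distrib)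
  have total: "(\<integral>\<^sup>+ t. \<integral>\<^sup>+ x. ennreal (centred_dens S y x t) \<partial>lborel \<partial>lborel) < \<infinity>"
    using total_mass_finite by (simp add: nn_integral_centred_dens)
  show ?thesis
    unfolding centred_target[symmetric]
    by (rule centred.not_geometrically_ergodicI[OF total B(2) B(1) _ _ tail])
       (auto simp: lower_mass_pos)
qed

end

theorem mainTheorem9:
  fixes S :: "real^'p^'p" and y :: "real^'p"
  assumes "transpose S = S"
    and "\<forall>v. v \<noteq> 0 \<longrightarrow> 0 < v \<bullet> (S *v v)"
  shows "\<not> geometrically_ergodic (centred_dens S y) (theta_posterior S y)
         \<and> uniformly_ergodic (noncentred_dens S y) (theta_posterior S y)"
proof -
  interpret gauss_model S y
    using assms by unfold_locales auto
  show ?thesis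
    using not_geometrically_ergodic_centred uniformly_ergodic_noncentred by blast
qed

end
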